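(* Let $\mathbf{P}$ be a fixed $a\times b$ pattern matrix of rank $r$, $\mathbf{B}$ its $m\times n$ blown up matrix, $\mathbf{W}$ an $m\times n$ Wigner-noise and $\mathbf{A}=\mathbf{B}+\mathbf{W}$. Let $\mathbf{y}_1,\dots,\mathbf{y}_r\in\mathbb{R}^m$ and $\mathbf{x}_1,\dots,\mathbf{x}_r\in\mathbb{R}^n$ be orthonormal systems of left- and right-hand side singular vectors of $\mathbf{A}$ corresponding to its $r$ largest singular values, and let $\mathbf{Y}=(\mathbf{y}_1,\dots,\mathbf{y}_r)$ ($m\times r$) and $\mathbf{X}=(\mathbf{x}_1,\dots,\mathbf{x}_r)$ ($n\times r$). Then, under the growth condition GC1, the $a$-variance of the rows of $\mathbf{Y}$ and the $b$-variance of the rows of $\mathbf{X}$ satisfy, almost surely, $$S_a^2(\mathbf{Y})=\mathcal{O}\left(\frac{m+n}{mn}\right)\quad\text{and}\quad S_b^2(\mathbf{X})=\mathcal{O}\left(\frac{m+n}{mn}\right).$$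
   Context: Wigner-noise: an $m\times n$ real random matrix $\mathbf{W}$ with independent entries $w_{ij}$, $\mathbb{E}(w_{ij})=0$, uniformly bounded: $|w_{ij}|\le K$ for all $i,j$, with a constant $K>0$ independent of $m$ and $n$. Blown up matrix: given an $a\times b$ pattern matrix $\mathbf{P}$ with entries $0\le p_{ij}\le1$ and positive integers $m_1,\dots,m_a$ with $\sum_i m_i=m$ and $n_1,\dots,n_b$ with $\sum_j n_j=n$, the blown up matrix $\mathbf{B}$ is the $m\times n$ matrix divided into $a\times b$ blocks, where block $(i,j)$ is an $m_i\times n_j$ matrix with all entries equal to $p_{ij}$. The pattern $\mathbf{P}$ (with $a,b$) is fixed, while $m,n$ and the block sizes vary. GC1: there are constants $0<c<1$ and $0<d<1$, independent of $m,n$, such that $m_i/m\ge c$ for $i=1,\dots,a$ and $n_j/n\ge d$ for $j=1,\dots,b$. Singular vectors are paired: $\mathbf{A}\mathbf{x}_i=z_i\mathbf{y}_i$ where $z_1,\dots,z_r$ are the $r$ largest singular values of $\mathbf{A}$. Variances: let $\mathbf{y}^1,\dots,\mathbf{y}^m\in\mathbb{R}^r$ be the rows of $\mathbf{Y}$ and $\mathbf{x}^1,\dots,\mathbf{x}^n\in\mathbb{R}^r$ the rows of $\mathbf{X}$. Then $$S_a^2(\mathbf{Y})=\min_{\{A'_1,\dots,A'_a\}}\sum_{i=1}^a\sum_{j\in A'_i}\|\mathbf{y}^j-\bar{\mathbf{y}}^i\|^2,\quad \bar{\mathbf{y}}^i=\frac1{|A'_i|}\sum_{j\in A'_i}\mathbf{y}^j,$$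 $$S_b^2(\mathbf{X})=\min_{\{B'_1,\dots,B'_b\}}\sum_{i=1}^b\sum_{j\in B'_i}\|\mathbf{x}^j-\bar{\mathbf{x}}^i\|^2,\quad \bar{\mathbf{x}}^i=\frac1{|B'_i|}\sum_{j\in B'_i}\mathbf{x}^j,$$ the minima being over all partitions of $\{1,\dots,m\}$ into $a$ parts and of $\{1,\dots,n\}$ into $b$ parts, respectively. Almost surely: a property $\mathcal{P}_{m,n}$ holds almost surely for the random matrices $\mathbf{A}_{m\times n}$ if $\mathbb{P}(\exists\, m_0,n_0\in\mathbb{N}$ such that for all $m\ge m_0$ and $n\ge n_0$, $\mathbf{A}_{m\times n}$ has $\mathcal{P}_{m,n})=1$, where $m,n$ and the block sizes grow subject to the stated growth condition and $K$ is kept fixed. A bound $\mathcal{O}(f(m,n))$ holds almost surely if there is a constant $C$ independent of $m,n$ such that the bound $\le C f(m,n)$ holds almost surely in this sense. *)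

theory Defs
  imports
    "HOL-Probability.Probability"
    "HOL-Library.Disjoint_Sets"
    "Jordan_Normal_Form.Matrix"
    "Jordan_Normal_Form.DL_Rank"
begin

definition pattern_matrix :: "nat \<Rightarrow> nat \<Rightarrow> real mat \<Rightarrow> bool" where
  "pattern_matrix a b P \<longleftrightarrow>
     P \<in> carrier_mat a b \<and> (\<forall>i<a. \<forall>j<b. 0 \<le> P $$ (i, j) \<and> P $$ (i, j) \<le> 1)"

definition block_sizes :: "nat \<Rightarrow> nat \<Rightarrow> nat list \<Rightarrow> bool" where
  "block_sizes k m ms \<longleftrightarrow> length ms = k \<and> (\<forall>i<k. 0 < ms ! i) \<and> sum_list ms = m"

(* The index of the block that contains position p when {..<sum_list ms} is cut
   into consecutive intervals of lengths ms ! 0, ms ! 1, ... *)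
definition block_index :: "nat list \<Rightarrow> nat \<Rightarrow> nat" where
  "block_index ms p = (LEAST k. p < sum_list (take (Suc k) ms))"

definition blown_up :: "real mat \<Rightarrow> nat list \<Rightarrow> nat list \<Rightarrow> real mat" where
  "blown_up P ms ns =
     Matrix.mat (sum_list ms) (sum_list ns) (\<lambda>(p, q). P $$ (block_index ms p, block_index ns q))"

definition GC1 :: "real \<Rightarrow> real \<Rightarrow> nat list \<Rightarrow> nat list \<Rightarrow> bool" where
  "GC1 c d ms ns \<longleftrightarrow>
     (\<forall>i<length ms. real (ms ! i) / real (sum_list ms) \<ge> c) \<and>
     (\<forall>j<length ns. real (ns ! j) / real (sum_list ns) \<ge> d)"

definition wigner_noise ::
    "'w measure \<Rightarrow> real \<Rightarrow> nat \<Rightarrow> nat \<Rightarrow> ('w \<Rightarrow> real mat) \<Rightarrow> bool" where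
  "wigner_noise M K m n W \<longleftrightarrow>
     (\<forall>\<omega>\<in>space M. W \<omega> \<in> carrier_mat m n) \<and>
     prob_space.indep_vars M (\<lambda>_. borel) (\<lambda>(i, j) \<omega>. W \<omega> $$ (i, j)) ({..<m} \<times> {..<n}) \<and>
     (\<forall>i<m. \<forall>j<n. prob_space.expectation M (\<lambda>\<omega>. W \<omega> $$ (i, j)) = 0) \<and>
     (\<forall>i<m. \<forall>j<n. AE \<omega> in M. \<bar>W \<omega> $$ (i, j)\<bar> \<le> K)"

(* Note that orthogonal_mat of the library does not normalise the columns. *)
definition orthonormal_cols :: "real mat \<Rightarrow> bool" where
  "orthonormal_cols Q \<longleftrightarrow> transpose_mat Q * Q = 1\<^sub>m (dim_col Q)"

(* zs lists all min m n singular values of an m x n matrix with multiplicity in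
   decreasing order, read off from a singular value decomposition A = U S V^T. *)
definition singular_values :: "real mat \<Rightarrow> real list \<Rightarrow> bool" where
  "singular_values A zs \<longleftrightarrow>
     length zs = min (dim_row A) (dim_col A) \<and>
     sorted_wrt (\<ge>) zs \<and> (\<forall>z\<in>set zs. 0 \<le> z) \<and>
     (\<exists>U V. U \<in> carrier_mat (dim_row A) (dim_row A) \<and> orthonormal_cols U \<and>
            V \<in> carrier_mat (dim_col A) (dim_col A) \<and> orthonormal_cols V \<and>
            A = U * Matrix.mat (dim_row A) (dim_col A) (\<lambda>(i, j). if i = j then zs ! i else 0)
                  * transpose_mat V)"

(* The columns of Y and X are paired left- and right-hand side singular vectors
   for the r largest singular values; r is at most the number of singular values. *)
definition top_singular_vectors :: "nat \<Rightarrow> real mat \<Rightarrow> real mat \<Rightarrow> real mat \<Rightarrow> bool" where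
  "top_singular_vectors r A Y X \<longleftrightarrow>
     Y \<in> carrier_mat (dim_row A) r \<and> orthonormal_cols Y \<and>
     X \<in> carrier_mat (dim_col A) r \<and> orthonormal_cols X \<and>
     (\<exists>zs. singular_values A zs \<and> r \<le> length zs \<and>
        (\<forall>k<r. A *\<^sub>v col X k = zs ! k \<cdot>\<^sub>v col Y k \<and>
               transpose_mat A *\<^sub>v col Y k = zs ! k \<cdot>\<^sub>v col X k))"

definition row_mean :: "real mat \<Rightarrow> nat set \<Rightarrow> real vec" where
  "row_mean Y S = Matrix.vec (dim_col Y) (\<lambda>l. (\<Sum>j\<in>S. Y $$ (j, l)) / real (card S))"

definition within_cluster :: "real mat \<Rightarrow> nat set \<Rightarrow> real" where
  "within_cluster Y S =
     (\<Sum>j\<in>S. (Matrix.row Y j - row_mean Y S) \<bullet> (Matrix.row Y j - row_mean Y S))"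

(* partition_on requires the parts to be nonempty, so the minimum ranges over a
   nonempty set exactly when k parts can be formed. *)
definition k_variance :: "nat \<Rightarrow> real mat \<Rightarrow> real" where
  "k_variance k Y =
     Min ((\<lambda>Q. \<Sum>S\<in>Q. within_cluster Y S) ` {Q. partition_on {..<dim_row Y} Q \<and> card Q = k})"

end

theory Submission
  imports Defs
begin

text \<open>
  Since A x = z y for paired singular vectors, y = B x / z + W x / z. The first summand is constant
  on the row blocks, so clustering the rows by blocks leaves a variance of at most
  r ||W||^2 / z_r^2. It remains to see that ||W|| = O(sqrt (m + n)) almost surely and that
  z_r is of order sqrt (m n). The former follows from Hoeffding's inequality, a union bound over
  nets of the two unit balls and Borel-Cantelli over the level sets of m + n. For the
  latter, r independent columns of the pattern give an r-dimensional space of vectors, constant on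
  the column blocks, on which |B x| is at least a constant times sqrt (m n) |x|; this survives the
  perturbation by W, and the min-max principle applies. The columns of X are treated by
  transposition.
\<close>

unbundle no inner_syntax
unbundle no vec_syntax

text \<open>Randomness enters through one event only, the norm bound for \<open>W\<close>; for an
  outcome in it the rest is deterministic. Block sizes and singular vectors can therefore be
  quantified inside the almost sure statement, with no measurable choice of \<open>Y\<close> and
  \<open>X\<close>. Noise matrices of different sizes may depend on each other arbitrarily, so only
  a union bound over the pairs (m, n) is available; the tail exp (- 2 (m + n)) beats the number of
  pairs with a given sum. The ratio of m to n is free. With L = (14 K)^2 and \<eta> = c d \<sigma> /
  4, where \<sigma> depends only on r chosen columns of the pattern, ||W||^2 is at most L (m + n),
  while the squares of the r largest singular values are at least \<eta> m n as soon as the noise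
  bound is at most that. This holds once m and n are both large, since (m + n) / (m n) = 1 / m + 1 /
  n. The quotient of the two bounds is the claimed rate, with constant r L / \<eta>.\<close>

section \<open>Spectral norm bounds and finite nets of the unit ball\<close>

definition bilin :: "nat \<Rightarrow> nat \<Rightarrow> (nat \<Rightarrow> nat \<Rightarrow> real) \<Rightarrow> (nat \<Rightarrow> real) \<Rightarrow> (nat \<Rightarrow> real) \<Rightarrow> real" where
  "bilin m n w x y = (\<Sum>i<m. \<Sum>j<n. w i j * x i * y j)"

text \<open>The spectral norm is at most \<open>s\<close>. A one-sided bound is enough because
  \<open>x\<close> may be negated, and balls in place of spheres admit zero vectors and net
  points.\<close>

definition opnorm_le :: "nat \<Rightarrow> nat \<Rightarrow> (nat \<Rightarrow> nat \<Rightarrow> real) \<Rightarrow> real \<Rightarrow> bool" where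
  "opnorm_le m n w s \<longleftrightarrow>
     (\<forall>x y. (\<Sum>i<m. (x i)\<^sup>2) \<le> 1 \<longrightarrow> (\<Sum>j<n. (y j)\<^sup>2) \<le> 1 \<longrightarrow> bilin m n w x y \<le> s)"

text \<open>Dividing these integer vectors by 4 sqrt n gives a 1/4-net of the unit ball.\<close>

definition lattice_net :: "nat \<Rightarrow> (nat \<Rightarrow> int) set" where
  "lattice_net n = {z \<in> {..<n} \<rightarrow>\<^sub>E {- (16 * int n)..16 * int n}. (\<Sum>i<n. (z i)\<^sup>2) \<le> 16 * int n}"

definition net_point :: "nat \<Rightarrow> (nat \<Rightarrow> int) \<Rightarrow> nat \<Rightarrow> real" where
  "net_point n z i = real_of_int (z i) / (4 * sqrt (real n))"

lemma finite_lattice_net: "finite (lattice_net n)"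
proof (rule finite_subset)
  show "lattice_net n \<subseteq> {..<n} \<rightarrow>\<^sub>E {- (16 * int n)..16 * int n}"
    by (auto simp: lattice_net_def)
qed (simp add: finite_PiE)

lemma abs_le_square_int: "\<bar>k\<bar> \<le> (k::int)\<^sup>2"
  using self_le_power[of "\<bar>k\<bar>" 2] by (cases "k = 0") auto

lemma sum_half_power_abs_le: "(\<Sum>k\<in>{- int N..int N}. (1/2::real) ^ nat \<bar>k\<bar>) \<le> 3"
proof -
  have "(\<Sum>k\<in>{- int N..int N}. (1/2::real) ^ nat \<bar>k\<bar>) = 3 - 2 * (1/2) ^ N"
  proof (induction N)
    case (Suc N)
    have "{- int (Suc N)..int (Suc N)} = insert (- int (Suc N)) (insert (int (Suc N)) {- int N..int N})"
      by auto
    then show ?case using Suc by (simp add: nat_add_distrib)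
  qed simp
  then show ?thesis by simp
qed

text \<open>
  Weight each integer vector z by 2 to the power - (|z_1| + ... + |z_n|): on the net this is at
  least 2 to the power - 16 n, while the weights of all integer vectors sum to at most 3 to the
  power n.
\<close>

lemma card_lattice_net: "real (card (lattice_net n)) \<le> 2 ^ (18 * n)"
proof -
  let ?B = "{- (16 * int n)..16 * int n}"
  have "real (card (lattice_net n)) * (1/2) ^ (16 * n) = (\<Sum>z\<in>lattice_net n. (1/2) ^ (16 * n))"
    by simp
  also have "\<dots> \<le> (\<Sum>z\<in>lattice_net n. \<Prod>i<n. (1/2::real) ^ nat \<bar>z i\<bar>)"
  proof (rule sum_mono)
    fix z assume z: "z \<in> lattice_net n"
    have "(\<Sum>i<n. \<bar>z i\<bar>) \<le> (\<Sum>i<n. (z i)\<^sup>2)"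
      by (intro sum_mono abs_le_square_int)
    also have "\<dots> \<le> 16 * int n" using z by (auto simp: lattice_net_def)
    finally have "int (\<Sum>i<n. nat \<bar>z i\<bar>) \<le> 16 * int n" by simp
    then have "(\<Sum>i<n. nat \<bar>z i\<bar>) \<le> 16 * n" by linarith
    then have "(1/2::real) ^ (16 * n) \<le> (1/2) ^ (\<Sum>i<n. nat \<bar>z i\<bar>)"
      by (intro power_decreasing) auto
    then show "(1/2::real) ^ (16 * n) \<le> (\<Prod>i<n. (1/2) ^ nat \<bar>z i\<bar>)"
      by (simp add: power_sum)
  qed
  also have "\<dots> \<le> (\<Sum>z\<in>{..<n} \<rightarrow>\<^sub>E ?B. \<Prod>i<n. (1/2::real) ^ nat \<bar>z i\<bar>)"
    by (rule sum_mono2) (auto simp: lattice_net_def finite_PiE prod_nonneg)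
  also have "\<dots> = (\<Prod>i<n. \<Sum>k\<in>?B. (1/2::real) ^ nat \<bar>k\<bar>)"
    by (rule prod_sum_PiE[symmetric]) auto
  also have "\<dots> = (\<Sum>k\<in>?B. (1/2::real) ^ nat \<bar>k\<bar>) ^ n" by simp
  \<comment> \<open>The factor 3 is rounded up to 4 to make the final count a power of 2.\<close>
  also have "\<dots> \<le> 4 ^ n"
    using sum_half_power_abs_le[of "16 * n"] by (intro power_mono) (auto intro!: sum_nonneg)
  finally have "real (card (lattice_net n)) \<le> 4 ^ n * 2 ^ (16 * n)"
    by (simp add: field_simps power_divide)
  also have "(4::real) ^ n * 2 ^ (16 * n) = 2 ^ (18 * n)"
    by (simp add: power_mult power_mult_distrib[symmetric])
  finally show ?thesis .
qed

lemma abs_le_one_of_sum_squares: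
  fixes x :: "nat \<Rightarrow> real"
  assumes "(\<Sum>i<n. (x i)\<^sup>2) \<le> 1" "i < n"
  shows "\<bar>x i\<bar> \<le> 1"
proof -
  have "(x i)\<^sup>2 \<le> (\<Sum>i<n. (x i)\<^sup>2)"
    using assms(2) by (intro member_le_sum) auto
  then have "(x i)\<^sup>2 \<le> 1" using assms(1) by linarith
  then show ?thesis by (simp add: abs_square_le_1)
qed

lemma net_point_norm:
  assumes "z \<in> lattice_net n" "0 < n"
  shows "(\<Sum>i<n. (net_point n z i)\<^sup>2) \<le> 1"
proof -
  have "(\<Sum>i<n. (net_point n z i)\<^sup>2) = real_of_int (\<Sum>i<n. (z i)\<^sup>2) / (16 * real n)"
    by (simp add: net_point_def power_divide power_mult_distrib sum_divide_distrib)
  also have "\<dots> \<le> real_of_int (16 * int n) / (16 * real n)"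
    using assms by (intro divide_right_mono) (auto simp: lattice_net_def simp del: of_int_sum of_int_mult)
  finally show ?thesis using assms by simp
qed

text \<open>On a grid of width 1 / (4 sqrt n) each coordinate errs by at most the width, so the
  squared error is at most 1/16. The factor 4 makes the scaled error again a vector of the unit
  ball, to which the supremum of the form applies.\<close>

lemma net_approx:
  assumes x: "(\<Sum>i<n. (x i)\<^sup>2) \<le> 1" and n: "0 < n"
  obtains z where "z \<in> lattice_net n" "(\<Sum>i<n. (4 * (x i - net_point n z i))\<^sup>2) \<le> 1"
proof -
  define s where "s = 4 * sqrt (real n)"
  have s: "s > 0" "s\<^sup>2 = 16 * real n" using n by (auto simp: s_def power_mult_distrib)
  \<comment> \<open>Rounding towards zero enlarges no coordinate, so the net point stays in the
    ball; rounding to the nearest integer might leave it.\<close>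
  define z where "z = (\<lambda>i\<in>{..<n}. if 0 \<le> x i then \<lfloor>s * x i\<rfloor> else \<lceil>s * x i\<rceil>)"
  have round: "\<bar>real_of_int (z i)\<bar> \<le> \<bar>s * x i\<bar>" "\<bar>s * x i - real_of_int (z i)\<bar> \<le> 1" if "i < n" for i
  proof -
    show "\<bar>real_of_int (z i)\<bar> \<le> \<bar>s * x i\<bar>"
    proof (cases "0 \<le> x i")
      case True
      then have "0 \<le> s * x i" using s by simp
      then show ?thesis using that True by (simp add: z_def)
    next
      case False
      then have "s * x i < 0" using s by (simp add: mult_pos_neg)
      moreover from this have "\<lceil>s * x i\<rceil> \<le> 0" by linarith
      ultimately show ?thesis using that False by (simp add: z_def)
    qed
    show "\<bar>s * x i - real_of_int (z i)\<bar> \<le> 1"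
      using that unfolding z_def by (simp; linarith)
  qed
  have "real_of_int (\<Sum>i<n. (z i)\<^sup>2) = (\<Sum>i<n. (real_of_int (z i))\<^sup>2)" by simp
  also have "\<dots> \<le> (\<Sum>i<n. (s * x i)\<^sup>2)"
    using round(1) by (intro sum_mono) (auto simp: abs_le_square_iff)
  also have "\<dots> = 16 * real n * (\<Sum>i<n. (x i)\<^sup>2)"
    by (simp add: power_mult_distrib s sum_distrib_left)
  also have "\<dots> \<le> 16 * real n" using x by (simp add: mult_left_le)
  finally have zsum: "(\<Sum>i<n. (z i)\<^sup>2) \<le> 16 * int n" by linarith
  have "z i \<in> {- (16 * int n)..16 * int n}" if "i < n" for i
  proof -
    have "(z i)\<^sup>2 \<le> (\<Sum>i<n. (z i)\<^sup>2)" using that by (intro member_le_sum) auto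
    then have "\<bar>z i\<bar> \<le> 16 * int n" using zsum abs_le_square_int[of "z i"] by linarith
    then show ?thesis by auto
  qed
  then have mem: "z \<in> lattice_net n"
    using zsum by (auto simp: lattice_net_def z_def PiE_iff)
  have "(\<Sum>i<n. (4 * (x i - net_point n z i))\<^sup>2) \<le> (\<Sum>i<n. 1 / real n)"
  proof (rule sum_mono)
    fix i assume "i \<in> {..<n}"
    then have "(s * x i - real_of_int (z i))\<^sup>2 \<le> 1"
      using round(2) by (simp add: abs_square_le_1)
    moreover have eq: "4 * (x i - net_point n z i) = 4 * (s * x i - real_of_int (z i)) / s"
      using s(1) unfolding net_point_def s_def[symmetric] by (simp add: field_simps)
    ultimately show "(4 * (x i - net_point n z i))\<^sup>2 \<le> 1 / real n"
      using n unfolding eq power_divide power_mult_distrib s(2) by (simp add: divide_simps)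
  qed
  then show ?thesis using that[OF mem] n by simp
qed

lemma bilin_add_left: "bilin m n w (\<lambda>i. x i + x' i) y = bilin m n w x y + bilin m n w x' y"
  by (simp add: bilin_def algebra_simps sum.distrib)

lemma bilin_add_right: "bilin m n w x (\<lambda>i. y i + y' i) = bilin m n w x y + bilin m n w x y'"
  by (simp add: bilin_def algebra_simps sum.distrib)

lemma bilin_scale_left: "bilin m n w (\<lambda>i. c * x i) y = c * bilin m n w x y"
  by (simp add: bilin_def algebra_simps sum_distrib_left)

lemma bilin_scale_right: "bilin m n w x (\<lambda>i. c * y i) = c * bilin m n w x y"
  by (simp add: bilin_def algebra_simps sum_distrib_left)

text \<open>Crude, but uniform in the vectors: it makes the supremum in the net argument finite,
  without which an inequality s \<le> t + s / 2 could not be solved for s.\<close>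

lemma bilin_le_sum_abs:
  assumes "(\<Sum>i<m. (x i)\<^sup>2) \<le> 1" "(\<Sum>j<n. (y j)\<^sup>2) \<le> 1"
  shows "bilin m n w x y \<le> (\<Sum>i<m. \<Sum>j<n. \<bar>w i j\<bar>)"
  unfolding bilin_def
proof (intro sum_mono)
  fix i j assume "i \<in> {..<m}" "j \<in> {..<n}"
  then have "\<bar>x i\<bar> \<le> 1" "\<bar>y j\<bar> \<le> 1"
    using abs_le_one_of_sum_squares[OF assms(1), of i] abs_le_one_of_sum_squares[OF assms(2), of j] by auto
  then have "\<bar>w i j\<bar> * \<bar>x i\<bar> * \<bar>y j\<bar> \<le> \<bar>w i j\<bar> * 1 * 1"
    by (intro mult_mono) auto
  then show "w i j * x i * y j \<le> \<bar>w i j\<bar>"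
    using abs_ge_self[of "w i j * x i * y j"] by (simp add: abs_mult)
qed

text \<open>For the supremum s over both balls, passing to net points costs s / 4 in each argument,
  so s \<le> t + s / 2.\<close>

lemma opnorm_le_of_net:
  assumes "0 < m" "0 < n"
    and net: "\<And>z z'. z \<in> lattice_net m \<Longrightarrow> z' \<in> lattice_net n \<Longrightarrow>
                bilin m n w (net_point m z) (net_point n z') \<le> t"
  shows "opnorm_le m n w (2 * t)"
proof -
  define D where "D = {(x, y). (\<Sum>i<m. (x i)\<^sup>2) \<le> (1::real) \<and> (\<Sum>j<n. (y j)\<^sup>2) \<le> (1::real)}"
  define s where "s = (SUP (x, y)\<in>D. bilin m n w x y)"
  have bdd: "bdd_above ((\<lambda>(x, y). bilin m n w x y) ` D)"
    by (rule bdd_aboveI2[where M = "\<Sum>i<m. \<Sum>j<n. \<bar>w i j\<bar>"]) (auto simp: D_def bilin_le_sum_abs)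
  have ub: "bilin m n w x y \<le> s" if "(x, y) \<in> D" for x y
    using cSUP_upper[OF that bdd] by (simp add: s_def)
  have "bilin m n w x y \<le> t + s / 2" if xy: "(x, y) \<in> D" for x y
  proof -
    have x: "(\<Sum>i<m. (x i)\<^sup>2) \<le> 1" and y: "(\<Sum>j<n. (y j)\<^sup>2) \<le> 1"
      using xy by (auto simp: D_def)
    obtain z where z: "z \<in> lattice_net m" "(\<Sum>i<m. (4 * (x i - net_point m z i))\<^sup>2) \<le> 1"
      using net_approx[OF x assms(1)] .
    obtain z' where z': "z' \<in> lattice_net n" "(\<Sum>i<n. (4 * (y i - net_point n z' i))\<^sup>2) \<le> 1"
      using net_approx[OF y assms(2)] .
    have "bilin m n w x y =
        bilin m n w (\<lambda>i. net_point m z i + 1/4 * (4 * (x i - net_point m z i))) y"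
      by (rule arg_cong2[where f = "bilin m n w"]) (auto simp: fun_eq_iff field_simps)
    also have "\<dots> = bilin m n w (net_point m z) y
        + 1/4 * bilin m n w (\<lambda>i. 4 * (x i - net_point m z i)) y"
      unfolding bilin_add_left bilin_scale_left ..
    also have "bilin m n w (net_point m z) y =
        bilin m n w (net_point m z) (\<lambda>i. net_point n z' i + 1/4 * (4 * (y i - net_point n z' i)))"
      by (rule arg_cong2[where f = "bilin m n w"]) (auto simp: fun_eq_iff field_simps)
    also have "\<dots> = bilin m n w (net_point m z) (net_point n z')
        + 1/4 * bilin m n w (net_point m z) (\<lambda>i. 4 * (y i - net_point n z' i))"
      unfolding bilin_add_right bilin_scale_right ..
    \<comment> \<open>The left error is paired with \<open>y\<close>, the right error with the net
      point of \<open>x\<close>; both pairs lie in \<open>D\<close> because net points have norm at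
      most 1.\<close>
    also have "\<dots> + 1/4 * bilin m n w (\<lambda>i. 4 * (x i - net_point m z i)) y \<le> t + 1/4 * s + 1/4 * s"
      using z z' y assms net_point_norm
      by (intro add_mono mult_left_mono net ub) (auto simp: D_def)
    finally show ?thesis by simp
  qed
  moreover have "D \<noteq> {}" by (auto simp: D_def intro!: exI[of _ "\<lambda>_. 0"])
  ultimately have "s \<le> t + s / 2"
    unfolding s_def by (intro cSUP_least) (auto simp: s_def)
  then show ?thesis
    using ub by (force simp: opnorm_le_def D_def)
qed

lemma bilin_transpose: "bilin n m (\<lambda>i j. w j i) x y = bilin m n w y x"
  unfolding bilin_def by (subst sum.swap) (simp add: mult_ac)

lemma opnorm_le_transpose: "opnorm_le m n w s \<Longrightarrow> opnorm_le n m (\<lambda>i j. w j i) s"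
  unfolding opnorm_le_def bilin_transpose[of n m w] by blast

text \<open>Duality: the form is tested with \<open>x\<close> proportional to the image of
  \<open>y\<close>.\<close>

lemma opnorm_leD:
  assumes "opnorm_le m n w s"
  shows "(\<Sum>i<m. (\<Sum>j<n. w i j * y j)\<^sup>2) \<le> s\<^sup>2 * (\<Sum>j<n. (y j)\<^sup>2)"
proof -
  define v where "v = (\<lambda>i. \<Sum>j<n. w i j * y j)"
  define p q where "p = sqrt (\<Sum>i<m. (v i)\<^sup>2)" and "q = sqrt (\<Sum>j<n. (y j)\<^sup>2)"
  have p: "p \<ge> 0" and p2: "(\<Sum>i<m. (v i)\<^sup>2) = p\<^sup>2" and q: "q \<ge> 0" and q2: "(\<Sum>j<n. (y j)\<^sup>2) = q\<^sup>2"
    by (auto simp: p_def q_def sum_nonneg)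
  have "bilin m n w v y = (\<Sum>i<m. v i * (\<Sum>j<n. w i j * y j))"
    unfolding bilin_def sum_distrib_left by (intro sum.cong refl) (simp only: mult_ac)
  also have "\<dots> = (\<Sum>i<m. (v i)\<^sup>2)"
    by (simp only: v_def power2_eq_square)
  finally have bv: "bilin m n w v y = p\<^sup>2" by (simp only: p2)
  have "p \<le> s * q"
  \<comment> \<open>Both vectors are to be normalised, so zero norms are set aside; there
    \<open>s\<close> is nonnegative, and the image of a zero vector is zero.\<close>
  proof (cases "p = 0 \<or> q = 0")
    case True
    have "bilin m n w (\<lambda>_. 0) (\<lambda>_. 0) \<le> s"
      using assms[unfolded opnorm_le_def, rule_format, of "\<lambda>_. 0" "\<lambda>_. 0"] by simp
    then have "0 \<le> s" by (simp add: bilin_def)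
    moreover have "p = 0" if "q = 0"
    proof -
      have "(\<Sum>j<n. (y j)\<^sup>2) = 0" using q2 that by simp
      then have "\<forall>j\<in>{..<n}. y j = 0" by (subst (asm) sum_nonneg_eq_0_iff) auto
      then show ?thesis by (simp add: p_def v_def)
    qed
    ultimately show ?thesis using True q by (cases "q = 0") auto
  next
    case False
    have "(\<Sum>i<m. (1/p * v i)\<^sup>2) = 1" "(\<Sum>j<n. (1/q * y j)\<^sup>2) = 1"
      using False unfolding power_mult_distrib sum_distrib_left[symmetric] p2 q2
      by (simp_all add: power_divide)
    then have "bilin m n w (\<lambda>i. 1/p * v i) (\<lambda>j. 1/q * y j) \<le> s"
      using assms[unfolded opnorm_le_def, rule_format, of "\<lambda>i. 1/p * v i" "\<lambda>j. 1/q * y j"] by simp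
    then have "1/p * (1/q * p\<^sup>2) \<le> s"
      unfolding bilin_scale_left bilin_scale_right bv .
    then show ?thesis using False p q by (simp add: field_simps power2_eq_square)
  qed
  then have "p\<^sup>2 \<le> (s * q)\<^sup>2" using p by (intro power_mono) auto
  then show ?thesis unfolding power_mult_distrib p2[symmetric] q2[symmetric] v_def .
qed

section \<open>Tail bounds for the noise and the almost sure norm bound\<close>

text \<open>The summands w i j x i y j are independent, centred and confined to intervals of length
  2 K |x i| |y j|, whose squares sum to 4 K^2 |x|^2 |y|^2 \<le> 4 K^2. Hoeffding's exponent 2 t^2 /
  (4 K^2) results.\<close>

lemma (in prob_space) wigner_bilin_tail:
  assumes W: "wigner_noise M K m n W" and "K > 0" "t > 0"
    and x: "(\<Sum>i<m. (x i)\<^sup>2) \<le> 1" and y: "(\<Sum>j<n. (y j)\<^sup>2) \<le> 1"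
  defines "S \<equiv> {\<omega> \<in> space M. t \<le> bilin m n (\<lambda>i j. W \<omega> $$ (i, j)) x y}"
  shows "S \<in> sets M" "prob S \<le> exp (- (t\<^sup>2 / (2 * K\<^sup>2)))"
proof -
  define I where "I = {..<m} \<times> {..<n}"
  define X where "X = (\<lambda>(i, j) \<omega>. W \<omega> $$ (i, j) * x i * y j)"
  define B where "B = (\<lambda>(i, j). K * \<bar>x i\<bar> * \<bar>y j\<bar>)"
  have "indep_vars (\<lambda>_. borel) (\<lambda>(i, j) \<omega>. W \<omega> $$ (i, j)) I"
    using W by (simp add: wigner_noise_def I_def)
  then have "indep_vars (\<lambda>_. borel)
      (\<lambda>p \<omega>. (\<lambda>v. v * x (fst p) * y (snd p)) ((\<lambda>(i, j) \<omega>. W \<omega> $$ (i, j)) p \<omega>)) I"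
    by (rule indep_vars_compose2) auto
  moreover have "(\<lambda>p \<omega>. (\<lambda>v. v * x (fst p) * y (snd p)) ((\<lambda>(i, j) \<omega>. W \<omega> $$ (i, j)) p \<omega>)) = X"
    by (auto simp: X_def fun_eq_iff)
  ultimately have indep: "indep_vars (\<lambda>_. borel) X I" by simp
  interpret Hoeffding_ineq M I X "\<lambda>p. - B p" B "\<Sum>p\<in>I. expectation (X p)"
  proof unfold_locales
    fix p assume "p \<in> I"
    then obtain i j where p: "p = (i, j)" "i < m" "j < n" by (auto simp: I_def)
    have "AE \<omega> in M. \<bar>W \<omega> $$ (i, j)\<bar> \<le> K" using W p by (auto simp: wigner_noise_def)
    then show "AE \<omega> in M. X p \<omega> \<in> {- B p..B p}"
    proof eventually_elim
      case (elim \<omega>)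
      then have "\<bar>W \<omega> $$ (i, j)\<bar> * \<bar>x i\<bar> * \<bar>y j\<bar> \<le> K * \<bar>x i\<bar> * \<bar>y j\<bar>"
        by (intro mult_right_mono) auto
      then have "\<bar>X p \<omega>\<bar> \<le> B p" by (simp add: X_def B_def p abs_mult)
      then show ?case by auto
    qed
  qed (auto simp: I_def indep[unfolded I_def])
  have mean: "expectation (X p) = 0" if "p \<in> I" for p
    using that W by (auto simp: X_def I_def wigner_noise_def)
  have sum_eq: "(\<Sum>p\<in>I. X p \<omega>) = bilin m n (\<lambda>i j. W \<omega> $$ (i, j)) x y" for \<omega>
    by (simp add: X_def I_def bilin_def sum.cartesian_product split_def)
  have S_eq: "S = {\<omega> \<in> space M. (\<Sum>p\<in>I. expectation (X p)) + t \<le> (\<Sum>p\<in>I. X p \<omega>)}"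
    by (simp add: S_def sum_eq mean)
  have "random_variable borel (\<lambda>\<omega>. \<Sum>p\<in>I. X p \<omega>)"
    by (intro borel_measurable_sum random_variable)
  then show "S \<in> sets M" unfolding S_eq by measurable
  have "(\<Sum>p\<in>I. (B p - - B p)\<^sup>2) = 4 * K\<^sup>2 * ((\<Sum>i<m. (x i)\<^sup>2) * (\<Sum>j<n. (y j)\<^sup>2))"
  proof -
    have "(\<Sum>p\<in>I. (B p - - B p)\<^sup>2) = (\<Sum>p\<in>I. 4 * K\<^sup>2 * ((x (fst p))\<^sup>2 * (y (snd p))\<^sup>2))"
      by (intro sum.cong refl) (simp add: B_def split_def power_mult_distrib)
    then show ?thesis
      unfolding sum_distrib_left[symmetric] by (simp only: I_def sum_product sum.cartesian_product split_def)
  qed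
  also have "\<dots> \<le> 4 * K\<^sup>2 * (1 * 1)"
    using x y by (intro mult_left_mono mult_mono) (auto intro!: sum_nonneg)
  finally have le: "(\<Sum>p\<in>I. (B p - - B p)\<^sup>2) \<le> 4 * K\<^sup>2" by simp
  show "prob S \<le> exp (- (t\<^sup>2 / (2 * K\<^sup>2)))"
  \<comment> \<open>Hoeffding's bound divides by the sum of the squared lengths. If that is zero,
    the form vanishes and the event is empty because t > 0.\<close>
  proof (cases "(\<Sum>p\<in>I. (B p - - B p)\<^sup>2) > 0")
    case True
    have "prob S \<le> exp (- 2 * t\<^sup>2 / (\<Sum>p\<in>I. (B p - - B p)\<^sup>2))"
      unfolding S_eq by (rule Hoeffding_ineq_ge) (use \<open>t > 0\<close> True in auto)
    also have "\<dots> \<le> exp (- (2 * t\<^sup>2 / (4 * K\<^sup>2)))"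
    proof -
      have "2 * t\<^sup>2 / (4 * K\<^sup>2) \<le> 2 * t\<^sup>2 / (\<Sum>p\<in>I. (B p - - B p)\<^sup>2)"
        by (rule divide_left_mono[OF le]) (use True \<open>K > 0\<close> in auto)
      then show ?thesis by simp
    qed
    finally show ?thesis by simp
  next
    case False
    then have "(\<Sum>p\<in>I. (B p - - B p)\<^sup>2) = 0"
      by (meson sum_nonneg zero_le_power2 antisym_conv not_le)
    then have "B p = 0" if "p \<in> I" for p
      using that by (subst (asm) sum_nonneg_eq_0_iff) (auto simp: I_def)
    then have "x i * y j = 0" if "i < m" "j < n" for i j
      using that \<open>K > 0\<close> by (force simp: B_def I_def)
    then have "bilin m n w x y = 0" for w
      unfolding bilin_def by (intro sum.neutral ballI) (simp add: mult.assoc)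
    then have "S = {}" using \<open>t > 0\<close> by (simp add: S_def)
    then show ?thesis by simp
  qed
qed

text \<open>The pairs of net points number at most 2^(18 (m + n)), hence at most e^(18 (m + n)),
  while the deviation 7 K sqrt (m + n) has exponent 49/2 (m + n), which leaves room for 2 (m + n).
  Passing from the nets to the balls doubles 7 to 14. An exceptional set \<open>E\<close>, a finite
  union of measurable events, avoids measuring the failure of \<open>opnorm_le\<close>
  itself.\<close>

lemma (in prob_space) wigner_opnorm_tail:
  assumes W: "wigner_noise M K m n W" and "K > 0" and mn: "0 < m" "0 < n"
  obtains E where "E \<in> sets M" "prob E \<le> exp (- 2 * real (m + n))"
    "\<And>\<omega>. \<omega> \<in> space M - E \<Longrightarrow> opnorm_le m n (\<lambda>i j. W \<omega> $$ (i, j)) (14 * K * sqrt (real (m + n)))"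
proof -
  define t where "t = 7 * K * sqrt (real (m + n))"
  have t: "t > 0" using \<open>K > 0\<close> mn by (simp add: t_def)
  define S where "S z z' = {\<omega> \<in> space M.
      t \<le> bilin m n (\<lambda>i j. W \<omega> $$ (i, j)) (net_point m z) (net_point n z')}" for z z'
  define L where "L = lattice_net m \<times> lattice_net n"
  define E where "E = (\<Union>(z, z')\<in>L. S z z')"
  note tail = wigner_bilin_tail[OF W \<open>K > 0\<close> t net_point_norm net_point_norm, OF _ mn(1) _ mn(2), folded S_def]
  have fin: "finite L" by (simp add: L_def finite_lattice_net)
  have ES: "E \<in> sets M"
    unfolding E_def using fin tail(1) by (auto simp: L_def)
  have "prob E \<le> (\<Sum>(z, z')\<in>L. prob (S z z'))"
    unfolding E_def split_def
    by (rule finite_measure_subadditive_finite[OF fin]) (use tail(1) in \<open>auto simp: L_def\<close>)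
  also have "\<dots> \<le> (\<Sum>p\<in>L. exp (- (t\<^sup>2 / (2 * K\<^sup>2))))"
    by (rule sum_mono) (use tail(2) in \<open>auto simp: L_def\<close>)
  also have "\<dots> = real (card (lattice_net m)) * real (card (lattice_net n)) * exp (- (t\<^sup>2 / (2 * K\<^sup>2)))"
    by (simp add: L_def card_cartesian_product)
  also have "\<dots> \<le> 2 ^ (18 * m) * 2 ^ (18 * n) * exp (- (t\<^sup>2 / (2 * K\<^sup>2)))"
    by (intro mult_right_mono mult_mono card_lattice_net) auto
  also have "\<dots> = 2 ^ (18 * (m + n)) * exp (- (49 / 2 * real (m + n)))"
  proof -
    have "t\<^sup>2 / (2 * K\<^sup>2) = 49 / 2 * real (m + n)"
      using \<open>K > 0\<close> by (simp add: t_def power_mult_distrib field_simps)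
    then show ?thesis by (simp only: power_add[symmetric] distrib_left)
  qed
  also have "\<dots> \<le> exp 1 ^ (18 * (m + n)) * exp (- (49 / 2 * real (m + n)))"
    using exp_ge_add_one_self[of 1] by (intro mult_right_mono power_mono) auto
  also have "\<dots> = exp (real (18 * (m + n)) - 49 / 2 * real (m + n))"
    by (simp add: exp_of_nat_mult[symmetric] exp_add[symmetric])
  also have "\<dots> \<le> exp (- 2 * real (m + n))"
    unfolding exp_le_cancel_iff of_nat_mult by linarith
  finally have "prob E \<le> exp (- 2 * real (m + n))" .
  moreover have "opnorm_le m n (\<lambda>i j. W \<omega> $$ (i, j)) (14 * K * sqrt (real (m + n)))"
    if "\<omega> \<in> space M - E" for \<omega>
  proof -
    have "opnorm_le m n (\<lambda>i j. W \<omega> $$ (i, j)) (2 * t)"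
      by (rule opnorm_le_of_net[OF mn]) (use that in \<open>force simp: E_def L_def S_def\<close>)
    then show ?thesis by (simp add: t_def mult.assoc)
  qed
  ultimately show ?thesis using that ES by blast
qed

text \<open>Grouping the pairs by their sum turns the doubly indexed family into a sequence, as
  Borel-Cantelli requires, and yields one threshold on m + n.\<close>

lemma (in prob_space) wigner_opnorm_eventually:
  assumes W: "\<And>m n. wigner_noise M K m n (W m n)" and "K > 0"
  shows "AE \<omega> in M. \<exists>k. \<forall>m n. 0 < m \<longrightarrow> 0 < n \<longrightarrow> k \<le> m + n \<longrightarrow>
           opnorm_le m n (\<lambda>i j. W m n \<omega> $$ (i, j)) (14 * K * sqrt (real (m + n)))"
proof -
  have "\<exists>E. E \<in> sets M \<and> prob E \<le> exp (- 2 * real (m + n)) \<and>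
      (\<forall>\<omega>\<in>space M - E. 0 < m \<longrightarrow> 0 < n \<longrightarrow>
         opnorm_le m n (\<lambda>i j. W m n \<omega> $$ (i, j)) (14 * K * sqrt (real (m + n))))" for m n
  proof (cases "0 < m \<and> 0 < n")
    case True
    then show ?thesis using wigner_opnorm_tail[OF W \<open>K > 0\<close>, of m n] by metis
  qed (auto intro!: exI[of _ "{}"])
  then obtain E where E: "\<And>m n. E m n \<in> sets M" "\<And>m n. prob (E m n) \<le> exp (- 2 * real (m + n))"
    "\<And>m n \<omega>. \<omega> \<in> space M - E m n \<Longrightarrow> 0 < m \<Longrightarrow> 0 < n \<Longrightarrow>
         opnorm_le m n (\<lambda>i j. W m n \<omega> $$ (i, j)) (14 * K * sqrt (real (m + n)))"
    by metis
  \<comment> \<open>The level m + n = k: since m < k, the truncated difference \<open>k - m\<close>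
    is a genuine one and positive.\<close>
  define A where "A k = (\<Union>m\<in>{..<k}. E m (k - m))" for k
  have A: "A k \<in> sets M" for k using E(1) by (auto simp: A_def)
  have "prob (A k) \<le> exp (- 1) ^ k" for k
  proof -
    have "prob (A k) \<le> (\<Sum>m<k. prob (E m (k - m)))"
      unfolding A_def by (rule finite_measure_subadditive_finite) (use E(1) in auto)
    also have "\<dots> \<le> (\<Sum>m<k. exp (- 2 * real k))"
    proof (rule sum_mono)
      fix m assume "m \<in> {..<k}"
      then show "prob (E m (k - m)) \<le> exp (- 2 * real k)" using E(2)[of m "k - m"] by simp
    qed
    also have "\<dots> = real k * exp (- 2 * real k)" by simp
    \<comment> \<open>The number k of pairs on the level is absorbed by e^k, leaving a geometric
      series.\<close>
    also have "\<dots> \<le> exp (real k) * exp (- 2 * real k)"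
      by (rule mult_right_mono) (use exp_ge_add_one_self[of "real k"] in linarith, simp)
    also have "\<dots> = exp (- 1) ^ k"
      by (simp add: exp_add[symmetric] exp_of_nat_mult[symmetric])
    finally show ?thesis .
  qed
  then have "summable (\<lambda>k. prob (A k))"
    by (intro summable_comparison_test'[OF summable_geometric[of "exp (- 1 :: real)"]]) auto
  then have "AE \<omega> in M. eventually (\<lambda>k. \<omega> \<in> space M - A k) sequentially"
    by (intro borel_cantelli_AE1 A) (auto simp: emeasure_eq_measure)
  then show ?thesis
  proof eventually_elim
    case (elim \<omega>)
    then obtain k where k: "\<And>l. l \<ge> k \<Longrightarrow> \<omega> \<in> space M - A l"
      by (auto simp: eventually_sequentially)
    have "opnorm_le m n (\<lambda>i j. W m n \<omega> $$ (i, j)) (14 * K * sqrt (real (m + n)))"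
      if "0 < m" "0 < n" "k \<le> m + n" for m n
    proof (rule E(3))
      have "m \<in> {..<m + n}" "m + n - m = n" using that by auto
      then have "E m n \<subseteq> A (m + n)" unfolding A_def by (metis UN_upper)
      then show "\<omega> \<in> space M - E m n" using k[OF that(3)] by auto
    qed (use that in auto)
    then show ?case by blast
  qed
qed

section \<open>Cluster variances and the partition into blocks\<close>

text \<open>Expanding around the mean, the cross term vanishes because the deviations sum to zero.
  This allows any convenient centre in upper bounds for the variance.\<close>

lemma sum_squares_mean_le:
  fixes y :: "nat \<Rightarrow> real"
  assumes "finite S"
  shows "(\<Sum>j\<in>S. (y j - (\<Sum>i\<in>S. y i) / real (card S))\<^sup>2) \<le> (\<Sum>j\<in>S. (y j - g)\<^sup>2)"
proof (cases "S = {}")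
  case False
  define \<mu> where "\<mu> = (\<Sum>i\<in>S. y i) / real (card S)"
  have "(\<Sum>i\<in>S. y i) = \<mu> * real (card S)"
    using False assms by (simp add: \<mu>_def)
  then have dev: "(\<Sum>j\<in>S. y j - \<mu>) = 0" by (simp add: sum_subtractf)
  have "(\<Sum>j\<in>S. (y j - g)\<^sup>2) = (\<Sum>j\<in>S. (y j - \<mu>)\<^sup>2 + 2 * (\<mu> - g) * (y j - \<mu>) + (\<mu> - g)\<^sup>2)"
    by (intro sum.cong refl) (simp add: power2_eq_square algebra_simps)
  also have "\<dots> = (\<Sum>j\<in>S. (y j - \<mu>)\<^sup>2) + real (card S) * (\<mu> - g)\<^sup>2"
    unfolding sum.distrib sum_distrib_left[symmetric] dev by simp
  finally show ?thesis by (simp add: \<mu>_def)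
qed simp

lemma within_cluster_le:
  assumes "finite S" "S \<subseteq> {..<dim_row Y}"
  shows "within_cluster Y S \<le> (\<Sum>j\<in>S. \<Sum>l<dim_col Y. (Y $$ (j, l) - g l)\<^sup>2)"
proof -
  let ?\<mu> = "\<lambda>l. (\<Sum>i\<in>S. Y $$ (i, l)) / real (card S)"
  have "within_cluster Y S = (\<Sum>j\<in>S. \<Sum>l<dim_col Y. (Y $$ (j, l) - ?\<mu> l)\<^sup>2)"
    unfolding within_cluster_def
    using assms(2) by (intro sum.cong refl)
      (auto simp: scalar_prod_def row_mean_def power2_eq_square atLeast0LessThan intro!: sum.cong)
  also have "\<dots> = (\<Sum>l<dim_col Y. \<Sum>j\<in>S. (Y $$ (j, l) - ?\<mu> l)\<^sup>2)"
    by (rule sum.swap)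
  also have "\<dots> \<le> (\<Sum>l<dim_col Y. \<Sum>j\<in>S. (Y $$ (j, l) - g l)\<^sup>2)"
    by (intro sum_mono sum_squares_mean_le assms)
  also have "\<dots> = (\<Sum>j\<in>S. \<Sum>l<dim_col Y. (Y $$ (j, l) - g l)\<^sup>2)"
    by (rule sum.swap)
  finally show ?thesis .
qed

lemma k_variance_le:
  assumes "partition_on {..<dim_row Y} Q"
  shows "k_variance (card Q) Y \<le> (\<Sum>S\<in>Q. within_cluster Y S)"
proof -
  have "finite {Q. partition_on {..<dim_row Y} Q}"
    by (rule finitely_many_partition_on) simp
  then show ?thesis
    unfolding k_variance_def using assms
    by (intro Min_le finite_imageI image_eqI[of _ _ Q]) (auto elim: finite_subset[rotated])
qed

lemma sum_list_take_Suc: "i < length ms \<Longrightarrow> sum_list (take (Suc i) ms) = sum_list (take i ms) + (ms ! i :: nat)"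
  by (simp add: take_Suc_conv_app_nth)

lemma sum_list_take_mono: "i \<le> j \<Longrightarrow> sum_list (take i ms) \<le> sum_list (take j (ms :: nat list))"
proof -
  assume "i \<le> j"
  then obtain k where "j = i + k" using le_Suc_ex by blast
  then show ?thesis by (simp add: take_add)
qed

lemma block_index_eqI:
  assumes "sum_list (take i ms) \<le> p" "p < sum_list (take (Suc i) ms)"
  shows "block_index ms p = i"
  unfolding block_index_def
proof (rule Least_equality)
  fix k assume k: "p < sum_list (take (Suc k) ms)"
  show "i \<le> k"
  proof (rule ccontr)
    assume "\<not> i \<le> k"
    then have "sum_list (take (Suc k) ms) \<le> sum_list (take i ms)"
      by (intro sum_list_take_mono) simp
    then show False using k assms(1) by simp
  qed
qed fact

lemma block_index_less:
  assumes "p < sum_list ms"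
  shows "block_index ms p < length ms"
proof -
  have "length ms \<noteq> 0" using assms by auto
  then have "block_index ms p \<le> length ms - 1"
    unfolding block_index_def using assms by (intro Least_le) simp
  then show ?thesis using \<open>length ms \<noteq> 0\<close> by linarith
qed

text \<open>Each i is the block index of exactly \<open>ms ! i\<close> positions. Norms of
  block-constant vectors thus become sums weighted by block sizes, to which GC1 applies.\<close>

lemma sum_block_index:
  fixes f :: "nat \<Rightarrow> real"
  shows "(\<Sum>p<sum_list ms. f (block_index ms p)) = (\<Sum>i<length ms. real (ms ! i) * f i)"
proof -
  have "(\<Sum>p<sum_list (take k ms). f (block_index ms p)) = (\<Sum>i<k. real (ms ! i) * f i)"
    if "k \<le> length ms" for k
    using that
  proof (induction k)
    case (Suc k)
    let ?s = "\<lambda>k. sum_list (take k ms)"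
    have s: "?s (Suc k) = ?s k + ms ! k" using Suc.prems by (intro sum_list_take_Suc) simp
    then have split: "{..<?s (Suc k)} = {..<?s k} \<union> {?s k..<?s (Suc k)}" by auto
    have "(\<Sum>p\<in>{?s k..<?s (Suc k)}. f (block_index ms p)) = (\<Sum>p\<in>{?s k..<?s (Suc k)}. f k)"
      by (intro sum.cong refl arg_cong[of _ _ f] block_index_eqI) auto
    also have "\<dots> = real (ms ! k) * f k" by (simp add: s)
    finally show ?case
      unfolding split using Suc by (subst sum.union_disjoint) auto
  qed simp
  from this[of "length ms"] show ?thesis by simp
qed

text \<open>The blocks themselves are the competing partition, with \<open>g\<close> supplying a
  free centre for each block.\<close>

lemma k_variance_block_le:
  assumes ms: "block_sizes a m ms" and Y: "Y \<in> carrier_mat m r"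
  shows "k_variance a Y \<le> (\<Sum>p<m. \<Sum>l<r. (Y $$ (p, l) - g (block_index ms p) l)\<^sup>2)"
proof -
  have len: "length ms = a" and pos: "\<And>i. i < a \<Longrightarrow> 0 < ms ! i" and m: "m = sum_list ms"
    using ms by (auto simp: block_sizes_def)
  define B where "B i = {p. p < m \<and> block_index ms p = i}" for i
  define Q where "Q = B ` {..<a}"
  define f where "f p = (\<Sum>l<r. (Y $$ (p, l) - g (block_index ms p) l)\<^sup>2)" for p
  have ne: "B i \<noteq> {}" if "i < a" for i
  proof -
    let ?p = "sum_list (take i ms)"
    have lt: "?p < sum_list (take (Suc i) ms)"
      using that pos[OF that] len by (simp add: sum_list_take_Suc)
    also have "\<dots> \<le> sum_list (take (length ms) ms)"
      using that len by (intro sum_list_take_mono) simp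
    finally have "?p \<in> B i"
      using block_index_eqI[of i ms ?p] lt by (simp add: B_def m)
    then show ?thesis by auto
  qed
  have "B i \<inter> B j = {}" if "i \<noteq> j" for i j using that by (auto simp: B_def)
  \<comment> \<open>Disjoint nonempty blocks are distinct, so \<open>Q\<close> has exactly
    \<open>a\<close> parts; positivity of the block sizes is what makes them nonempty.\<close>
  then have inj: "inj_on B {..<a}" using ne by (metis inf.idem inj_onI lessThan_iff)
  have "\<Union>Q = {..<m}"
    using block_index_less[of _ ms] by (auto simp: Q_def B_def m len)
  moreover have "disjoint Q" by (auto simp: disjoint_def Q_def B_def)
  moreover have "{} \<notin> Q" using ne unfolding Q_def by (metis imageE lessThan_iff)
  ultimately have part: "partition_on {..<dim_row Y} Q"
    using Y by (simp add: partition_on_def)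
  have "k_variance a Y \<le> (\<Sum>S\<in>Q. within_cluster Y S)"
    using k_variance_le[OF part] inj by (simp add: Q_def card_image)
  also have "\<dots> = (\<Sum>i<a. within_cluster Y (B i))"
    by (simp add: Q_def sum.reindex[OF inj])
  also have "\<dots> \<le> (\<Sum>i<a. \<Sum>p\<in>B i. \<Sum>l<r. (Y $$ (p, l) - g i l)\<^sup>2)"
  proof (rule sum_mono)
    fix i
    show "within_cluster Y (B i) \<le> (\<Sum>p\<in>B i. \<Sum>l<r. (Y $$ (p, l) - g i l)\<^sup>2)"
      using within_cluster_le[of "B i" Y "g i"] Y by (auto simp: B_def)
  qed
  also have "\<dots> = (\<Sum>i<a. \<Sum>p\<in>B i. \<Sum>l<r. (Y $$ (p, l) - g (block_index ms p) l)\<^sup>2)"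
    by (intro sum.cong refl) (simp add: B_def)
  also have "\<dots> = (\<Sum>i<a. \<Sum>p\<in>{p \<in> {..<m}. block_index ms p = i}. f p)"
    by (simp only: f_def B_def lessThan_iff)
  also have "\<dots> = (\<Sum>p<m. f p)"
    using block_index_less[of _ ms] by (intro sum.group) (auto simp: m len)
  finally show ?thesis by (simp add: f_def)
qed

text \<open>Meant for \<open>g\<close> from B x and \<open>e\<close> from W x. After division by
  \<open>z k\<close> the first part supplies the centres, and only the noise contributes.\<close>

lemma k_variance_perturbed_le:
  assumes ms: "block_sizes a m ms" and Y: "Y \<in> carrier_mat m r"
    and eq: "\<And>k p. k < r \<Longrightarrow> p < m \<Longrightarrow> z k * Y $$ (p, k) = g (block_index ms p) k + e p k"
    and e: "\<And>k. k < r \<Longrightarrow> (\<Sum>p<m. (e p k)\<^sup>2) \<le> \<epsilon>"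
    and z: "\<And>k. k < r \<Longrightarrow> \<kappa> \<le> (z k)\<^sup>2" and "\<kappa> > 0" "\<epsilon> \<ge> 0"
  shows "k_variance a Y \<le> real r * (\<epsilon> / \<kappa>)"
proof -
  have "k_variance a Y \<le> (\<Sum>p<m. \<Sum>k<r. (Y $$ (p, k) - g (block_index ms p) k / z k)\<^sup>2)"
    by (rule k_variance_block_le[OF ms Y, where g = "\<lambda>i k. g i k / z k"])
  also have "\<dots> = (\<Sum>k<r. \<Sum>p<m. (Y $$ (p, k) - g (block_index ms p) k / z k)\<^sup>2)"
    by (rule sum.swap)
  also have "\<dots> \<le> (\<Sum>k<r. \<epsilon> / \<kappa>)"
  proof (rule sum_mono)
    fix k assume "k \<in> {..<r}"
    then have k: "k < r" by simp
    have z0: "z k \<noteq> 0" using z[OF k] \<open>\<kappa> > 0\<close> by auto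
    have "(\<Sum>p<m. (Y $$ (p, k) - g (block_index ms p) k / z k)\<^sup>2) = (\<Sum>p<m. (e p k)\<^sup>2 / (z k)\<^sup>2)"
    proof (intro sum.cong refl)
      fix p assume "p \<in> {..<m}"
      then have "Y $$ (p, k) - g (block_index ms p) k / z k = e p k / z k"
        using eq[OF k, of p] z0 by (simp add: field_simps)
      then show "(Y $$ (p, k) - g (block_index ms p) k / z k)\<^sup>2 = (e p k)\<^sup>2 / (z k)\<^sup>2"
        by (simp add: power_divide)
    qed
    also have "\<dots> = (\<Sum>p<m. (e p k)\<^sup>2) / (z k)\<^sup>2" by (simp add: sum_divide_distrib)
    also have "\<dots> \<le> \<epsilon> / \<kappa>"
      using e[OF k] z[OF k] assms by (intro frac_le) auto
    finally show "(\<Sum>p<m. (Y $$ (p, k) - g (block_index ms p) k / z k)\<^sup>2) \<le> \<epsilon> / \<kappa>" .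
  qed
  finally show ?thesis by simp
qed

section \<open>Linear algebra: independent columns, coercivity, a min-max bound\<close>

lemma scalar_prod_self: "v \<in> carrier_vec n \<Longrightarrow> v \<bullet> v = (\<Sum>i<n. (v $ i)\<^sup>2 :: real)"
  by (simp add: scalar_prod_def power2_eq_square atLeast0LessThan)

lemma scalar_prod_self_eq_0:
  assumes "v \<in> carrier_vec n" "v \<bullet> v = (0::real)"
  shows "v = 0\<^sub>v n"
proof (rule eq_vecI)
  fix i assume "i < dim_vec (0\<^sub>v n :: real vec)"
  moreover have "\<forall>i\<in>{..<n}. (v $ i)\<^sup>2 = 0"
    using assms by (subst sum_nonneg_eq_0_iff[symmetric]) (auto simp: scalar_prod_self)
  ultimately show "v $ i = 0\<^sub>v n $ i" by auto
qed (use assms in auto)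

lemma isometry_of_left_inverse:
  fixes Q :: "real mat"
  assumes Q: "Q \<in> carrier_mat p k" and orth: "transpose_mat Q * Q = 1\<^sub>m k" and w: "w \<in> carrier_vec k"
  shows "(Q *\<^sub>v w) \<bullet> (Q *\<^sub>v w) = w \<bullet> w"
proof -
  have "(Q *\<^sub>v w) \<bullet> (Q *\<^sub>v w) = (transpose_mat Q *\<^sub>v (Q *\<^sub>v w)) \<bullet> w"
    using transpose_vec_mult_scalar[OF Q w, of "Q *\<^sub>v w"] Q w by simp
  also have "transpose_mat Q *\<^sub>v (Q *\<^sub>v w) = (transpose_mat Q * Q) *\<^sub>v w"
    using Q w by (intro assoc_mult_mat_vec[symmetric]) auto
  finally show ?thesis using w by (simp add: orth)
qed

text \<open>The Gram matrix \<open>G\<close> has the same kernel as \<open>A\<close>, so it is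
  invertible, and its inverse times the transpose of \<open>A\<close> is a left inverse
  \<open>L\<close> of \<open>A\<close>. From v = L (A v), Cauchy-Schwarz bounds |v| by the Frobenius
  norm of \<open>L\<close> times |A v|.\<close>

lemma full_column_rank_bound:
  fixes A :: "real mat"
  assumes A: "A \<in> carrier_mat n k"
    and ker: "\<And>v. v \<in> carrier_vec k \<Longrightarrow> A *\<^sub>v v = 0\<^sub>v n \<Longrightarrow> v = 0\<^sub>v k"
  obtains \<sigma> where "\<sigma> > 0" "\<And>v. v \<in> carrier_vec k \<Longrightarrow> \<sigma> * (v \<bullet> v) \<le> (A *\<^sub>v v) \<bullet> (A *\<^sub>v v)"
proof -
  define G where "G = transpose_mat A * A"
  have G: "G \<in> carrier_mat k k" using A by (simp add: G_def)
  have "det G \<noteq> 0"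
  proof
    assume "det G = 0"
    then obtain v where v: "v \<in> carrier_vec k" "v \<noteq> 0\<^sub>v k" "G *\<^sub>v v = 0\<^sub>v k"
      using det_0_iff_vec_prod_zero[OF G] by auto
    have "G *\<^sub>v v = transpose_mat A *\<^sub>v (A *\<^sub>v v)"
      unfolding G_def using A v by (intro assoc_mult_mat_vec) auto
    then have "(A *\<^sub>v v) \<bullet> (A *\<^sub>v v) = (G *\<^sub>v v) \<bullet> v"
      using transpose_vec_mult_scalar[OF A v(1), of "A *\<^sub>v v"] A v by simp
    then have "(A *\<^sub>v v) \<bullet> (A *\<^sub>v v) = 0" using v by simp
    then have "A *\<^sub>v v = 0\<^sub>v n" using A v by (intro scalar_prod_self_eq_0) auto
    then show False using ker v by auto
  qed
  then have "G \<in> Units (ring_mat TYPE(real) k ())" using det_non_zero_imp_unit[OF G] by simp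
  then obtain H where H: "H \<in> carrier_mat k k" "H * G = 1\<^sub>m k"
    by (auto simp: Units_def ring_mat_def)
  define L where "L = H * transpose_mat A"
  have L: "L \<in> carrier_mat k n" using H A by (simp add: L_def)
  have "L * A = H * (transpose_mat A * A)"
    unfolding L_def using H A by (intro assoc_mult_mat) auto
  then have LA: "L * A = 1\<^sub>m k" using H by (simp add: G_def)
  \<comment> \<open>The squared Frobenius norm of \<open>L\<close>, plus 1 so that 1 / C is positive
    even if \<open>L\<close> is zero, as for k = 0.\<close>
  define C where "C = 1 + (\<Sum>i<k. \<Sum>j<n. (L $$ (i, j))\<^sup>2)"
  have C: "C \<ge> 1" by (simp add: C_def sum_nonneg)
  have "1 / C * (v \<bullet> v) \<le> (A *\<^sub>v v) \<bullet> (A *\<^sub>v v)" if v: "v \<in> carrier_vec k" for v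
  proof -
    define w where "w = A *\<^sub>v v"
    have w: "w \<in> carrier_vec n" using A v by (simp add: w_def)
    have "L *\<^sub>v w = (L * A) *\<^sub>v v"
      unfolding w_def using L A v by (intro assoc_mult_mat_vec[symmetric]) auto
    then have Lw: "L *\<^sub>v w = v" using v by (simp add: LA)
    have "v $ i = (\<Sum>j<n. L $$ (i, j) * w $ j)" if "i < k" for i
    proof -
      have "v $ i = (L *\<^sub>v w) $ i" by (simp add: Lw)
      then show ?thesis using that L w
        by (simp add: scalar_prod_def atLeast0LessThan)
    qed
    then have "v \<bullet> v = (\<Sum>i<k. (\<Sum>j<n. L $$ (i, j) * w $ j)\<^sup>2)"
      using v by (simp add: scalar_prod_self)
    also have "\<dots> \<le> (\<Sum>i<k. (\<Sum>j<n. (L $$ (i, j))\<^sup>2) * (\<Sum>j<n. (w $ j)\<^sup>2))"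
      by (intro sum_mono Cauchy_Schwarz_ineq_sum)
    also have "\<dots> = (C - 1) * (w \<bullet> w)"
      using w by (simp add: C_def scalar_prod_self sum_distrib_right)
    also have "\<dots> \<le> C * (w \<bullet> w)"
      using w by (intro mult_right_mono) (auto simp: scalar_prod_self sum_nonneg)
    finally show ?thesis using C by (simp add: w_def field_simps)
  qed
  then show ?thesis using that[of "1 / C"] C by simp
qed

text \<open>A maximal independent set of columns has as many elements as the rank. Listed without
  repetition it forms a submatrix for which a nonzero kernel vector would be a linear dependence.
  Injectivity of \<open>js\<close> later keeps the selected column blocks apart.\<close>

lemma (in vec_space) rank_independent_columns:
  assumes A: "A \<in> carrier_mat n nc" and "rank A = r"
  obtains js where "inj_on js {..<r}" "\<And>l. l < r \<Longrightarrow> js l < nc"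
    "\<And>v. v \<in> carrier_vec r \<Longrightarrow> Matrix.mat n r (\<lambda>(i, l). A $$ (i, js l)) *\<^sub>v v = 0\<^sub>v n \<Longrightarrow> v = 0\<^sub>v r"
proof -
  obtain U where U: "maximal U (\<lambda>T. T \<subseteq> set (cols A) \<and> lin_indpt T)" "finite U"
    using maximal_exists_superset[of "set (cols A)" "\<lambda>T. T \<subseteq> set (cols A) \<and> lin_indpt T" "{}"]
      finite_lin_indpt2[of "{}"] by auto
  then have cU: "card U = r" using rank_card_indpt[OF A] assms(2) by simp
  have sub: "U \<subseteq> set (cols A)" and ind: "lin_indpt U" using U(1) by (auto simp: maximal_def)
  obtain us where us: "set us = U" "distinct us" using U(2) finite_distinct_list by blast
  then have len: "length us = r" using cU distinct_card by fastforce
  have "\<exists>j<nc. us ! l = col A j" if "l < r" for l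
    using that us sub len A
    by (metis (no_types, lifting) carrier_matD(2) cols_length cols_nth in_set_conv_nth nth_mem subsetD)
  then obtain js where js: "\<And>l. l < r \<Longrightarrow> js l < nc \<and> us ! l = col A (js l)" by metis
  have inj: "inj_on js {..<r}"
    using js us len by (metis inj_onI lessThan_iff nth_eq_iff_index_eq)
  define A' where "A' = Matrix.mat n r (\<lambda>(i, l). A $$ (i, js l))"
  have A': "A' \<in> carrier_mat n r" by (simp add: A'_def)
  have cols: "cols A' = us"
    by (rule nth_equalityI) (use js len A in \<open>auto simp: A'_def\<close>)
  have "v = 0\<^sub>v r" if "v \<in> carrier_vec r" "A' *\<^sub>v v = 0\<^sub>v n" for v
    using lin_depI[OF A' that(1) _ that(2)] ind us by (auto simp: cols)
  then show ?thesis using that[OF inj] js by (simp add: A'_def)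
qed

text \<open>
  The test vector is F t, with t chosen such that F t is orthogonal to the first r - 1 right
  singular vectors: these are r - 1 linear equations for r unknowns, padded by a zero row in R.
\<close>

lemma singular_value_lower_bound:
  assumes A: "A \<in> carrier_mat m n" and sv: "singular_values A zs" and r: "0 < r" "r \<le> length zs"
    and F: "F \<in> carrier_mat n r" and "\<kappa> > 0"
    and Fpos: "\<And>t. t \<in> carrier_vec r \<Longrightarrow> t \<noteq> 0\<^sub>v r \<Longrightarrow> 0 < (F *\<^sub>v t) \<bullet> (F *\<^sub>v t)"
    and bound: "\<And>t. t \<in> carrier_vec r \<Longrightarrow>
       \<kappa> * ((F *\<^sub>v t) \<bullet> (F *\<^sub>v t)) \<le> (A *\<^sub>v (F *\<^sub>v t)) \<bullet> (A *\<^sub>v (F *\<^sub>v t))"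
    and k: "k < r"
  shows "\<kappa> \<le> (zs ! k)\<^sup>2"
proof -
  obtain U V where U: "U \<in> carrier_mat m m" "transpose_mat U * U = 1\<^sub>m m"
    and V: "V \<in> carrier_mat n n" "transpose_mat V * V = 1\<^sub>m n"
    and AE: "A = U * Matrix.mat m n (\<lambda>(i, j). if i = j then zs ! i else 0) * transpose_mat V"
    and len: "length zs = min m n" and sorted: "sorted_wrt (\<ge>) zs" and nn: "\<And>z. z \<in> set zs \<Longrightarrow> 0 \<le> z"
    using sv A unfolding singular_values_def orthonormal_cols_def by auto
  define D where "D = Matrix.mat m n (\<lambda>(i, j). if i = j then zs ! i else 0)"
  define N where "N = transpose_mat V * F"
  have VT: "transpose_mat V \<in> carrier_mat n n" and D: "D \<in> carrier_mat m n" and N: "N \<in> carrier_mat n r"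
    using V F by (auto simp: D_def N_def)
  \<comment> \<open>For square matrices a left inverse is also a right inverse, so the transpose of
    \<open>V\<close> is an isometry as well and \<alpha> has the norm of \<open>v\<close>.\<close>
  have VV: "transpose_mat (transpose_mat V) * transpose_mat V = 1\<^sub>m n"
    using mat_mult_left_right_inverse[OF VT V(1) V(2)] by simp
  define R where "R = mat\<^sub>r r r (\<lambda>i. if i = r - 1 then 0\<^sub>v r else row N i)"
  have rn: "r \<le> n" "r \<le> m" using r len by auto
  have R: "R \<in> carrier_mat r r" by (simp add: R_def)
  have "det R = 0"
    unfolding R_def using r N rn by (intro det_row_0) auto
  then obtain t where t: "t \<in> carrier_vec r" "t \<noteq> 0\<^sub>v r" "R *\<^sub>v t = 0\<^sub>v r"
    using det_0_iff_vec_prod_zero[OF R] by auto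
  define v where "v = F *\<^sub>v t"
  define \<alpha> where "\<alpha> = transpose_mat V *\<^sub>v v"
  have v: "v \<in> carrier_vec n" using F t by (simp add: v_def)
  have \<alpha>: "\<alpha> \<in> carrier_vec n" using VT v by (simp add: \<alpha>_def)
  have "\<alpha> = N *\<^sub>v t"
    unfolding \<alpha>_def v_def N_def using VT F t by (intro assoc_mult_mat_vec[symmetric]) auto
  have \<alpha>0: "\<alpha> $ i = 0" if "i < r - 1" for i
  proof -
    have "\<alpha> $ i = row N i \<bullet> t" using \<open>\<alpha> = N *\<^sub>v t\<close> N that rn by simp
    also have "\<dots> = (R *\<^sub>v t) $ i" using that N rn by (simp add: R_def)
    finally show ?thesis using t that by simp
  qed
  have "A *\<^sub>v v = U *\<^sub>v (D *\<^sub>v \<alpha>)"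
  proof -
    have "A *\<^sub>v v = (U * D) *\<^sub>v \<alpha>"
      unfolding AE D_def[symmetric] \<alpha>_def using U D VT v by (intro assoc_mult_mat_vec) auto
    also have "\<dots> = U *\<^sub>v (D *\<^sub>v \<alpha>)" using U D \<alpha> by (intro assoc_mult_mat_vec) auto
    finally show ?thesis .
  qed
  then have "(A *\<^sub>v v) \<bullet> (A *\<^sub>v v) = (D *\<^sub>v \<alpha>) \<bullet> (D *\<^sub>v \<alpha>)"
    using isometry_of_left_inverse[OF U, of "D *\<^sub>v \<alpha>"] D \<alpha> by simp
  also have "\<dots> = (\<Sum>i<m. ((D *\<^sub>v \<alpha>) $ i)\<^sup>2)"
    using D \<alpha> by (intro scalar_prod_self) simp
  \<comment> \<open>The min-max step: the coordinates of \<alpha> before r - 1 vanish, and from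
    there on the singular values are at most \<open>zs ! (r - 1)\<close>, the r-th largest as
    indices start at 0.\<close>
  also have "\<dots> \<le> (\<Sum>i<m. if i < n then (zs ! (r - 1))\<^sup>2 * (\<alpha> $ i)\<^sup>2 else 0)"
  proof (rule sum_mono)
    fix i assume "i \<in> {..<m}"
    then have i: "i < m" by simp
    have Di: "(D *\<^sub>v \<alpha>) $ i = (if i < n then zs ! i * \<alpha> $ i else 0)"
    proof -
      have "(D *\<^sub>v \<alpha>) $ i = (\<Sum>j<n. (if i = j then zs ! i else 0) * \<alpha> $ j)"
        using i \<alpha> by (simp add: D_def scalar_prod_def atLeast0LessThan)
      also have "\<dots> = (\<Sum>j<n. if j = i then zs ! i * \<alpha> $ i else 0)"
        by (intro sum.cong) auto
      finally show ?thesis by simp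
    qed
    have "(zs ! i)\<^sup>2 * (\<alpha> $ i)\<^sup>2 \<le> (zs ! (r - 1))\<^sup>2 * (\<alpha> $ i)\<^sup>2" if "i < n"
    proof (cases "i < r - 1")
      case False
      have "i < length zs" using that i len by simp
      moreover have "zs ! i \<le> zs ! (r - 1)"
        using False calculation sorted_wrt_nth_less[OF sorted, of "r - 1" i] by (cases "i = r - 1") auto
      ultimately show ?thesis
        using nn by (intro mult_right_mono power_mono) auto
    qed (simp add: \<alpha>0)
    then show "((D *\<^sub>v \<alpha>) $ i)\<^sup>2 \<le> (if i < n then (zs ! (r - 1))\<^sup>2 * (\<alpha> $ i)\<^sup>2 else 0)"
      by (simp add: Di power_mult_distrib)
  qed
  also have "\<dots> = (\<Sum>i\<in>{..<m} \<inter> {..<n}. (zs ! (r - 1))\<^sup>2 * (\<alpha> $ i)\<^sup>2)"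
    by (subst sum.inter_restrict) auto
  also have "\<dots> \<le> (\<Sum>i<n. (zs ! (r - 1))\<^sup>2 * (\<alpha> $ i)\<^sup>2)"
    by (intro sum_mono2) auto
  also have "\<dots> = (zs ! (r - 1))\<^sup>2 * (\<alpha> \<bullet> \<alpha>)"
    using \<alpha> by (simp add: scalar_prod_self sum_distrib_left)
  also have "\<alpha> \<bullet> \<alpha> = v \<bullet> v"
    unfolding \<alpha>_def by (rule isometry_of_left_inverse[OF VT VV v])
  finally have "\<kappa> * (v \<bullet> v) \<le> (zs ! (r - 1))\<^sup>2 * (v \<bullet> v)"
    using bound[OF t(1)] by (simp add: v_def)
  then have "\<kappa> \<le> (zs ! (r - 1))\<^sup>2"
    using Fpos[OF t(1,2)] by (simp add: v_def)
  also have "\<dots> \<le> (zs ! k)\<^sup>2"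
  proof (rule power_mono)
    show "zs ! (r - 1) \<le> zs ! k"
      using sorted_wrt_nth_less[OF sorted, of k "r - 1"] k r by (cases "k = r - 1") auto
    show "0 \<le> zs ! (r - 1)" using r by (intro nn) auto
  qed
  finally show ?thesis .
qed

section \<open>Lower bound for the top singular values of the noisy blown up matrix\<close>

lemma mult_mat_vec_index:
  "A \<in> carrier_mat m n \<Longrightarrow> v \<in> carrier_vec n \<Longrightarrow> i < m \<Longrightarrow> (A *\<^sub>v v) $ i = (\<Sum>j<n. A $$ (i, j) * v $ j)"
  by (auto simp: scalar_prod_def atLeast0LessThan)

lemma opnorm_le_mult_mat_vec:
  assumes "opnorm_le m n (\<lambda>i j. W $$ (i, j)) s" "W \<in> carrier_mat m n" "v \<in> carrier_vec n"
  shows "(W *\<^sub>v v) \<bullet> (W *\<^sub>v v) \<le> s\<^sup>2 * (v \<bullet> v)"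
proof -
  have "(W *\<^sub>v v) \<bullet> (W *\<^sub>v v) = (\<Sum>i<m. (\<Sum>j<n. W $$ (i, j) * v $ j)\<^sup>2)"
    using assms by (subst scalar_prod_self[where n = m])
      (auto simp: mult_mat_vec_index simp del: index_mult_mat_vec intro!: sum.cong)
  then show ?thesis
    using opnorm_leD[OF assms(1), of "\<lambda>j. v $ j"] assms(3) by (simp add: scalar_prod_self)
qed

lemma scalar_prod_perturb:
  fixes B W :: "real mat"
  assumes B: "B \<in> carrier_mat m n" and W: "W \<in> carrier_mat m n" and v: "v \<in> carrier_vec n"
  shows "(B *\<^sub>v v) \<bullet> (B *\<^sub>v v) \<le>
    2 * (((B + W) *\<^sub>v v) \<bullet> ((B + W) *\<^sub>v v)) + 2 * ((W *\<^sub>v v) \<bullet> (W *\<^sub>v v))"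
proof -
  let ?b = "\<lambda>i. (B *\<^sub>v v) $ i" and ?w = "\<lambda>i. (W *\<^sub>v v) $ i"
  have add: "(B + W) *\<^sub>v v = B *\<^sub>v v + W *\<^sub>v v"
    using B W v by (rule add_mult_distrib_mat_vec)
  have car: "B *\<^sub>v v \<in> carrier_vec m" "W *\<^sub>v v \<in> carrier_vec m" "B *\<^sub>v v + W *\<^sub>v v \<in> carrier_vec m"
    using B W v by auto
  have "(\<Sum>i<m. (?b i)\<^sup>2) \<le> (\<Sum>i<m. 2 * (?b i + ?w i)\<^sup>2 + 2 * (?w i)\<^sup>2)"
  proof (rule sum_mono)
    fix i
    \<comment> \<open>This square is the difference of the two sides below.\<close>
    have "0 \<le> (?b i + 2 * ?w i)\<^sup>2" by simp
    then show "(?b i)\<^sup>2 \<le> 2 * (?b i + ?w i)\<^sup>2 + 2 * (?w i)\<^sup>2"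
      by (simp add: power2_eq_square algebra_simps)
  qed
  moreover have "(\<Sum>i<m. ((B *\<^sub>v v + W *\<^sub>v v) $ i)\<^sup>2) = (\<Sum>i<m. (?b i + ?w i)\<^sup>2)"
    using B W by (intro sum.cong) auto
  ultimately show ?thesis
    unfolding add scalar_prod_self[OF car(1)] scalar_prod_self[OF car(2)] scalar_prod_self[OF car(3)]
    by (simp only: sum.distrib sum_distrib_left)
qed

lemma blown_up_index:
  "p < sum_list ms \<Longrightarrow> q < sum_list ns \<Longrightarrow>
     blown_up P ms ns $$ (p, q) = P $$ (block_index ms p, block_index ns q)"
  by (simp add: blown_up_def)

lemma GC1_nth:
  assumes "GC1 c d ms ns" "block_sizes a m ms" "block_sizes b n ns"
  shows "i < a \<Longrightarrow> c * real m \<le> real (ms ! i)" "j < b \<Longrightarrow> d * real n \<le> real (ns ! j)"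
proof -
  have m: "m = sum_list ms" "length ms = a" and n: "n = sum_list ns" "length ns = b"
    using assms by (auto simp: block_sizes_def)
  show "c * real m \<le> real (ms ! i)" if "i < a"
    using assms(1) that m by (cases "m = 0") (auto simp: GC1_def field_simps)
  show "d * real n \<le> real (ns ! j)" if "j < b"
    using assms(1) that n by (cases "n = 0") (auto simp: GC1_def field_simps)
qed

text \<open>\<open>F\<close> spreads \<open>t\<close> over the selected column blocks, so |F t|^2 is
  the sum of n_l (t l)^2, with n_l the size of block \<open>js l\<close>. On row block i, the vector
  B F t equals (P' u) i, where P' consists of the selected columns of \<open>P\<close> and u l = n_l
  t l. GC1 for the rows gives a factor c m, coercivity of P' a factor \<sigma>, and GC1 for the
  columns a factor d n.\<close>

lemma blown_up_lower_bound:
  assumes inj: "inj_on js {..<r}" and js: "\<And>l. l < r \<Longrightarrow> js l < b"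
    and \<sigma>: "\<sigma> > 0" "\<And>v. v \<in> carrier_vec r \<Longrightarrow> \<sigma> * (v \<bullet> v) \<le>
      (Matrix.mat a r (\<lambda>(i, l). P $$ (i, js l)) *\<^sub>v v) \<bullet> (Matrix.mat a r (\<lambda>(i, l). P $$ (i, js l)) *\<^sub>v v)"
    and ms: "block_sizes a m ms" and ns: "block_sizes b n ns" and gc: "GC1 c d ms ns"
    and "0 < c" "0 < d" "0 < m" "0 < n" and t: "t \<in> carrier_vec r"
  defines "F \<equiv> Matrix.mat n r (\<lambda>(q, l). if block_index ns q = js l then 1 else 0 :: real)"
  shows "t \<noteq> 0\<^sub>v r \<Longrightarrow> 0 < (F *\<^sub>v t) \<bullet> (F *\<^sub>v t)"
    and "c * d * \<sigma> * (real m * real n) * ((F *\<^sub>v t) \<bullet> (F *\<^sub>v t)) \<le>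
         (blown_up P ms ns *\<^sub>v (F *\<^sub>v t)) \<bullet> (blown_up P ms ns *\<^sub>v (F *\<^sub>v t))"
proof -
  have m: "m = sum_list ms" "length ms = a" and n: "n = sum_list ns" "length ns = b"
    and npos: "\<And>j. j < b \<Longrightarrow> 0 < ns ! j"
    using ms ns by (auto simp: block_sizes_def)
  let ?N = "\<lambda>l. real (ns ! js l)"
  let ?P = "Matrix.mat a r (\<lambda>(i, l). P $$ (i, js l))"
  have F: "F \<in> carrier_mat n r" by (simp add: F_def)
  \<comment> \<open>The value of F t on column block \<open>j\<close>: \<open>t $ l\<close> if
    \<open>j\<close> is \<open>js l\<close>, and 0 on blocks that are not selected.\<close>
  define h where "h j = (\<Sum>l<r. if j = js l then t $ l else 0)" for j
  have Ft: "(F *\<^sub>v t) $ q = h (block_index ns q)" if "q < n" for q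
    unfolding mult_mat_vec_index[OF F t that] h_def
    using that by (intro sum.cong) (auto simp: F_def)
  have hjs: "h (js l) = t $ l" if "l < r" for l
  proof -
    have "h (js l) = (\<Sum>l'<r. if l' = l then t $ l else 0)"
      unfolding h_def using inj_onD[OF inj] that by (intro sum.cong) auto
    then show ?thesis using that by simp
  qed
  have h0: "h j = 0" if "j \<notin> js ` {..<r}" for j
    unfolding h_def using that by (intro sum.neutral) auto
  have reidx: "(\<Sum>j<b. f j * h j) = (\<Sum>l<r. f (js l) * t $ l)" for f :: "nat \<Rightarrow> real"
  proof -
    have "(\<Sum>j<b. f j * h j) = (\<Sum>j\<in>js ` {..<r}. f j * h j)"
      using js h0 by (intro sum.mono_neutral_right) auto
    also have "\<dots> = (\<Sum>l<r. f (js l) * h (js l))" by (simp add: sum.reindex[OF inj])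
    finally show ?thesis by (simp add: hjs)
  qed
  have FtFt: "(F *\<^sub>v t) \<bullet> (F *\<^sub>v t) = (\<Sum>l<r. ?N l * (t $ l)\<^sup>2)"
  proof -
    have "(F *\<^sub>v t) \<bullet> (F *\<^sub>v t) = (\<Sum>q<n. (h (block_index ns q))\<^sup>2)"
      using F t by (subst scalar_prod_self[where n = n]) (auto simp: Ft simp del: index_mult_mat_vec)
    also have "\<dots> = (\<Sum>j<b. real (ns ! j) * (h j)\<^sup>2)"
      using sum_block_index[of "\<lambda>j. (h j)\<^sup>2" ns] n by simp
    also have "\<dots> = (\<Sum>j<b. (real (ns ! j) * h j) * h j)"
      by (simp add: power2_eq_square mult_ac)
    also have "\<dots> = (\<Sum>l<r. (?N l * h (js l)) * t $ l)" by (rule reidx)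
    finally show ?thesis by (simp add: hjs power2_eq_square mult_ac)
  qed
  show "0 < (F *\<^sub>v t) \<bullet> (F *\<^sub>v t)" if "t \<noteq> 0\<^sub>v r"
  proof -
    have "t = 0\<^sub>v r" if "\<forall>l<r. t $ l = 0"
      using that t by (intro eq_vecI) auto
    then obtain l where l: "l < r" "t $ l \<noteq> 0" using \<open>t \<noteq> 0\<^sub>v r\<close> by blast
    then have "0 < ?N l * (t $ l)\<^sup>2" using npos js by simp
    also have "\<dots> \<le> (\<Sum>l<r. ?N l * (t $ l)\<^sup>2)" using l by (intro member_le_sum) auto
    finally show ?thesis by (simp add: FtFt)
  qed
  define u where "u = Matrix.vec r (\<lambda>l. ?N l * t $ l)"
  have u: "u \<in> carrier_vec r" by (simp add: u_def)
  have Pu: "?P *\<^sub>v u \<in> carrier_vec a" by (rule mult_mat_vec_carrier[OF _ u]) simp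
  have B: "blown_up P ms ns \<in> carrier_mat m n" by (simp add: blown_up_def m n)
  have BFt: "(blown_up P ms ns *\<^sub>v (F *\<^sub>v t)) $ p = (?P *\<^sub>v u) $ block_index ms p" if p: "p < m" for p
  proof -
    let ?i = "block_index ms p"
    have i: "?i < a" using p m block_index_less by auto
    have "(blown_up P ms ns *\<^sub>v (F *\<^sub>v t)) $ p = (\<Sum>q<n. blown_up P ms ns $$ (p, q) * (F *\<^sub>v t) $ q)"
      using B F t p by (intro mult_mat_vec_index) auto
    also have "\<dots> = (\<Sum>q<n. P $$ (?i, block_index ns q) * h (block_index ns q))"
      using p m n by (intro sum.cong) (auto simp: blown_up_index Ft)
    also have "\<dots> = (\<Sum>j<b. real (ns ! j) * (P $$ (?i, j) * h j))"
      using sum_block_index[of "\<lambda>j. P $$ (?i, j) * h j" ns] n by simp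
    also have "\<dots> = (\<Sum>j<b. (real (ns ! j) * P $$ (?i, j)) * h j)" by (simp add: mult_ac)
    also have "\<dots> = (\<Sum>l<r. (?N l * P $$ (?i, js l)) * t $ l)" by (rule reidx)
    also have "\<dots> = (\<Sum>l<r. ?P $$ (?i, l) * u $ l)"
      using i by (simp add: u_def mult_ac)
    also have "\<dots> = (?P *\<^sub>v u) $ ?i"
      using i u by (intro mult_mat_vec_index[symmetric]) auto
    finally show ?thesis .
  qed
  have "c * d * \<sigma> * (real m * real n) * ((F *\<^sub>v t) \<bullet> (F *\<^sub>v t))
      = c * real m * (\<sigma> * (d * real n * (\<Sum>l<r. ?N l * (t $ l)\<^sup>2)))"
    by (simp add: FtFt mult_ac)
  also have "\<dots> \<le> c * real m * (\<sigma> * (u \<bullet> u))"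
  proof (intro mult_left_mono)
    have "d * real n * (\<Sum>l<r. ?N l * (t $ l)\<^sup>2) = (\<Sum>l<r. d * real n * (?N l * (t $ l)\<^sup>2))"
      by (rule sum_distrib_left)
    \<comment> \<open>Of the two factors \<open>?N l\<close> in the square of \<open>u $ l\<close>,
      one is bounded below by d n; the other is kept to reproduce the norm of F t.\<close>
    also have "\<dots> \<le> (\<Sum>l<r. ?N l * (?N l * (t $ l)\<^sup>2))"
      using GC1_nth(2)[OF gc ms ns] js by (intro sum_mono mult_right_mono) auto
    also have "\<dots> = u \<bullet> u"
      by (simp add: scalar_prod_self[OF u]) (simp add: u_def power2_eq_square mult_ac)
    finally show "d * real n * (\<Sum>l<r. ?N l * (t $ l)\<^sup>2) \<le> u \<bullet> u" .
  qed (use \<open>0 < c\<close> \<sigma> in auto)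
  also have "\<dots> \<le> c * real m * ((?P *\<^sub>v u) \<bullet> (?P *\<^sub>v u))"
    using \<sigma>(2)[OF u] \<open>0 < c\<close> by (intro mult_left_mono) auto
  also have "\<dots> = (\<Sum>i<a. c * real m * ((?P *\<^sub>v u) $ i)\<^sup>2)"
    unfolding scalar_prod_self[OF Pu] by (rule sum_distrib_left)
  also have "\<dots> \<le> (\<Sum>i<a. real (ms ! i) * ((?P *\<^sub>v u) $ i)\<^sup>2)"
    using GC1_nth(1)[OF gc ms ns] by (intro sum_mono mult_right_mono) auto
  also have "\<dots> = (\<Sum>p<m. ((?P *\<^sub>v u) $ block_index ms p)\<^sup>2)"
    using sum_block_index[of "\<lambda>i. ((?P *\<^sub>v u) $ i)\<^sup>2" ms] m by simp
  also have "\<dots> = (blown_up P ms ns *\<^sub>v (F *\<^sub>v t)) \<bullet> (blown_up P ms ns *\<^sub>v (F *\<^sub>v t))"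
    using B F t by (subst scalar_prod_self[where n = m]) (auto simp: BFt simp del: index_mult_mat_vec)
  finally show "c * d * \<sigma> * (real m * real n) * ((F *\<^sub>v t) \<bullet> (F *\<^sub>v t)) \<le>
         (blown_up P ms ns *\<^sub>v (F *\<^sub>v t)) \<bullet> (blown_up P ms ns *\<^sub>v (F *\<^sub>v t))" .
qed

text \<open>Put q = c d \<sigma> m n. On the range of \<open>F\<close>, |B v|^2 \<ge> q |v|^2 and |W
  v|^2 \<le> (q / 4) |v|^2, so |B v|^2 \<le> 2 |A v|^2 + 2 |W v|^2 leaves |A v|^2 \<ge> (q / 4)
  |v|^2.\<close>

lemma top_singular_value_lower_bound:
  assumes inj: "inj_on js {..<r}" and js: "\<And>l. l < r \<Longrightarrow> js l < b"
    and \<sigma>: "\<sigma> > 0" "\<And>v. v \<in> carrier_vec r \<Longrightarrow> \<sigma> * (v \<bullet> v) \<le>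
      (Matrix.mat a r (\<lambda>(i, l). P $$ (i, js l)) *\<^sub>v v) \<bullet> (Matrix.mat a r (\<lambda>(i, l). P $$ (i, js l)) *\<^sub>v v)"
    and ms: "block_sizes a m ms" and ns: "block_sizes b n ns" and gc: "GC1 c d ms ns"
    and pos: "0 < c" "0 < d" "0 < m" "0 < n"
    and W: "W \<in> carrier_mat m n" and s: "opnorm_le m n (\<lambda>i j. W $$ (i, j)) s"
    and small: "s\<^sup>2 \<le> c * d * \<sigma> * (real m * real n) / 4"
    and sv: "singular_values (blown_up P ms ns + W) zs" and r: "r \<le> length zs" and k: "k < r"
  shows "c * d * \<sigma> * (real m * real n) / 4 \<le> (zs ! k)\<^sup>2"
proof -
  define F where "F = Matrix.mat n r (\<lambda>(q, l). if block_index ns q = js l then 1 else 0 :: real)"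
  have bl: "t \<noteq> 0\<^sub>v r \<Longrightarrow> 0 < (F *\<^sub>v t) \<bullet> (F *\<^sub>v t)"
    "c * d * \<sigma> * (real m * real n) * ((F *\<^sub>v t) \<bullet> (F *\<^sub>v t)) \<le>
       (blown_up P ms ns *\<^sub>v (F *\<^sub>v t)) \<bullet> (blown_up P ms ns *\<^sub>v (F *\<^sub>v t))"
    if "t \<in> carrier_vec r" for t
    unfolding F_def
    by (rule blown_up_lower_bound[OF inj js \<sigma> ms ns gc pos that]; assumption)+
  have F: "F \<in> carrier_mat n r" by (simp add: F_def)
  have B: "blown_up P ms ns \<in> carrier_mat m n"
    using ms ns by (simp add: blown_up_def block_sizes_def)
  show ?thesis
  proof (rule singular_value_lower_bound[OF _ sv _ r F _ bl(1) _ k])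
    show "blown_up P ms ns + W \<in> carrier_mat m n" using B W by simp
    show "0 < c * d * \<sigma> * (real m * real n) / 4" using pos \<sigma> by simp
    fix t :: "real vec"
    assume t: "t \<in> carrier_vec r"
    let ?v = "F *\<^sub>v t"
    have v: "?v \<in> carrier_vec n" using F t by simp
    have nn: "0 \<le> ?v \<bullet> ?v" using v by (simp add: scalar_prod_self sum_nonneg)
    have "s\<^sup>2 * (?v \<bullet> ?v) \<le> c * d * \<sigma> * (real m * real n) / 4 * (?v \<bullet> ?v)"
      by (rule mult_right_mono[OF small nn])
    then show "c * d * \<sigma> * (real m * real n) / 4 * (?v \<bullet> ?v) \<le>
        ((blown_up P ms ns + W) *\<^sub>v ?v) \<bullet> ((blown_up P ms ns + W) *\<^sub>v ?v)"
      using bl(2)[OF t] scalar_prod_perturb[OF B W v] opnorm_le_mult_mat_vec[OF s W v] by argo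
  qed (use k in auto)
qed

section \<open>Variance of the singular vectors and the almost sure bound\<close>

text \<open>Only A x = z y with |x| = 1 and a lower bound for z^2 enter, so the lemma serves
  \<open>Y\<close> directly and \<open>X\<close> after transposition.\<close>

lemma k_variance_singular_vectors_le:
  assumes ms: "block_sizes a m ms" and ns: "block_sizes b n ns"
    and W: "W \<in> carrier_mat m n" and s: "opnorm_le m n (\<lambda>i j. W $$ (i, j)) s"
    and Y: "Y \<in> carrier_mat m r" and X: "X \<in> carrier_mat n r"
    and eq: "\<And>k. k < r \<Longrightarrow> (blown_up P ms ns + W) *\<^sub>v col X k = z k \<cdot>\<^sub>v col Y k"
    and unit: "\<And>k. k < r \<Longrightarrow> col X k \<bullet> col X k = 1"
    and z: "\<And>k. k < r \<Longrightarrow> \<kappa> \<le> (z k)\<^sup>2" and \<kappa>: "\<kappa> > 0"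
  shows "k_variance a Y \<le> real r * (s\<^sup>2 / \<kappa>)"
proof (rule k_variance_perturbed_le[OF ms Y _ _ z \<kappa>])
  fix k assume k: "k < r"
  have x: "col X k \<in> carrier_vec n" using X k by auto
  have B: "blown_up P ms ns \<in> carrier_mat m n" and m: "m = sum_list ms" "n = sum_list ns"
    using ms ns by (auto simp: blown_up_def block_sizes_def)
  {
    fix p assume p: "p < m"
    have "z k * Y $$ (p, k) = ((blown_up P ms ns + W) *\<^sub>v col X k) $ p"
      using Y p k by (simp add: eq)
    also have "\<dots> = (blown_up P ms ns *\<^sub>v col X k) $ p + (W *\<^sub>v col X k) $ p"
      using B W x p by (simp add: add_mult_distrib_mat_vec[OF B W x])
    also have "(blown_up P ms ns *\<^sub>v col X k) $ p =
        (\<Sum>q<n. P $$ (block_index ms p, block_index ns q) * col X k $ q)"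
      using p m by (simp only: mult_mat_vec_index[OF B x p]) (auto simp: blown_up_index intro!: sum.cong)
    \<comment> \<open>The abstraction displays the image under the blown up matrix as a function of
      the block of \<open>p\<close> alone, so that it can act as a centre.\<close>
    finally show "z k * Y $$ (p, k) =
        (\<lambda>i k. \<Sum>q<n. P $$ (i, block_index ns q) * col X k $ q) (block_index ms p) k + (W *\<^sub>v col X k) $ p" .
  }
  have "(\<Sum>p<m. ((W *\<^sub>v col X k) $ p)\<^sup>2) = (W *\<^sub>v col X k) \<bullet> (W *\<^sub>v col X k)"
    using W x by (intro scalar_prod_self[symmetric]) auto
  also have "\<dots> \<le> s\<^sup>2 * (col X k \<bullet> col X k)"
    by (rule opnorm_le_mult_mat_vec[OF s W x])
  finally show "(\<Sum>p<m. ((W *\<^sub>v col X k) $ p)\<^sup>2) \<le> s\<^sup>2" by (simp add: unit[OF k])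
qed auto

lemma transpose_blown_up:
  assumes "pattern_matrix a b P" "block_sizes a m ms" "block_sizes b n ns"
  shows "transpose_mat (blown_up P ms ns) = blown_up (transpose_mat P) ns ms"
proof (rule eq_matI)
  fix q p assume "q < dim_row (blown_up (transpose_mat P) ns ms)" "p < dim_col (blown_up (transpose_mat P) ns ms)"
  then have "q < sum_list ns" "p < sum_list ms" by (auto simp: blown_up_def)
  moreover from this have "block_index ns q < b" "block_index ms p < a"
    using block_index_less assms by (auto simp: block_sizes_def)
  moreover have "dim_row P = a" "dim_col P = b" using assms(1) by (auto simp: pattern_matrix_def)
  ultimately show "transpose_mat (blown_up P ms ns) $$ (q, p) = blown_up (transpose_mat P) ns ms $$ (q, p)"
    by (simp add: blown_up_def)
qed (auto simp: blown_up_def)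

lemma orthonormal_cols_unit:
  assumes "orthonormal_cols Q" "Q \<in> carrier_mat p k" "l < k"
  shows "col Q l \<bullet> col Q l = 1"
proof -
  have "(transpose_mat Q * Q) $$ (l, l) = 1"
    using assms by (simp add: orthonormal_cols_def)
  then show ?thesis using assms by simp
qed

text \<open>A matrix and its transpose are paired through the same \<open>zs\<close>, so one lower
  bound, obtained from columns of \<open>P\<close>, covers both halves; only the variance estimate
  is repeated with rows and columns exchanged.\<close>

lemma k_variance_top_singular_vectors_le:
  assumes P: "pattern_matrix a b P" and inj: "inj_on js {..<r}" and js: "\<And>l. l < r \<Longrightarrow> js l < b"
    and \<sigma>: "\<sigma> > 0" "\<And>v. v \<in> carrier_vec r \<Longrightarrow> \<sigma> * (v \<bullet> v) \<le>
      (Matrix.mat a r (\<lambda>(i, l). P $$ (i, js l)) *\<^sub>v v) \<bullet> (Matrix.mat a r (\<lambda>(i, l). P $$ (i, js l)) *\<^sub>v v)"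
    and ms: "block_sizes a m ms" and ns: "block_sizes b n ns" and gc: "GC1 c d ms ns"
    and pos: "0 < c" "0 < d" "0 < m" "0 < n"
    and W: "W \<in> carrier_mat m n" and s: "opnorm_le m n (\<lambda>i j. W $$ (i, j)) s"
    and small: "s\<^sup>2 \<le> c * d * \<sigma> * (real m * real n) / 4"
    and top: "top_singular_vectors r (blown_up P ms ns + W) Y X"
  shows "k_variance a Y \<le> real r * (s\<^sup>2 / (c * d * \<sigma> * (real m * real n) / 4))"
    and "k_variance b X \<le> real r * (s\<^sup>2 / (c * d * \<sigma> * (real m * real n) / 4))"
proof -
  have B: "blown_up P ms ns \<in> carrier_mat m n"
    using ms ns by (simp add: blown_up_def block_sizes_def)
  have dim: "dim_row (blown_up P ms ns + W) = m" "dim_col (blown_up P ms ns + W) = n"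
    using W by auto
  from top obtain zs where Y: "Y \<in> carrier_mat m r" "orthonormal_cols Y"
    and X: "X \<in> carrier_mat n r" "orthonormal_cols X"
    and sv: "singular_values (blown_up P ms ns + W) zs" and r: "r \<le> length zs"
    and eqY: "\<And>k. k < r \<Longrightarrow> (blown_up P ms ns + W) *\<^sub>v col X k = zs ! k \<cdot>\<^sub>v col Y k"
    and eqX: "\<And>k. k < r \<Longrightarrow> transpose_mat (blown_up P ms ns + W) *\<^sub>v col Y k = zs ! k \<cdot>\<^sub>v col X k"
    unfolding top_singular_vectors_def dim by metis
  have z: "c * d * \<sigma> * (real m * real n) / 4 \<le> (zs ! k)\<^sup>2" if "k < r" for k
    by (rule top_singular_value_lower_bound[OF inj js \<sigma> ms ns gc pos W s small sv r that])
  have \<kappa>: "0 < c * d * \<sigma> * (real m * real n) / 4" using pos \<sigma> by simp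
  show "k_variance a Y \<le> real r * (s\<^sup>2 / (c * d * \<sigma> * (real m * real n) / 4))"
    by (rule k_variance_singular_vectors_le[OF ms ns W s Y(1) X(1) eqY
          orthonormal_cols_unit[OF X(2) X(1)] z \<kappa>])
  have WT: "transpose_mat W \<in> carrier_mat n m" using W by simp
  have "opnorm_le n m (\<lambda>i j. W $$ (j, i)) s" by (rule opnorm_le_transpose[OF s])
  then have sT: "opnorm_le n m (\<lambda>i j. transpose_mat W $$ (i, j)) s"
    unfolding opnorm_le_def bilin_def using W by simp
  have "transpose_mat (blown_up P ms ns + W) = blown_up (transpose_mat P) ns ms + transpose_mat W"
    using transpose_add[OF B W] transpose_blown_up[OF P ms ns] by simp
  then have "\<And>k. k < r \<Longrightarrow>
      (blown_up (transpose_mat P) ns ms + transpose_mat W) *\<^sub>v col Y k = zs ! k \<cdot>\<^sub>v col X k"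
    using eqX by simp
  then show "k_variance b X \<le> real r * (s\<^sup>2 / (c * d * \<sigma> * (real m * real n) / 4))"
    by (rule k_variance_singular_vectors_le[OF ns ms WT sT X(1) Y(1) _
          orthonormal_cols_unit[OF Y(2) Y(1)] z \<kappa>])
qed

theorem theorem12:
  fixes M :: "'w measure"
    and P :: "real mat"
    and W :: "nat \<Rightarrow> nat \<Rightarrow> 'w \<Rightarrow> real mat"
    and K c d :: real
    and a b r :: nat
  assumes "prob_space M"
    and "pattern_matrix a b P"
    and "vec_space.rank a P = r"
    and "K > 0"
    and "\<And>m n. wigner_noise M K m n (W m n)"
    and "0 < c" "c < 1" "0 < d" "d < 1"
  shows "\<exists>C::real. AE \<omega> in M. \<exists>m0 n0. \<forall>m\<ge>m0. \<forall>n\<ge>n0. \<forall>ms ns Y X.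
           block_sizes a m ms \<longrightarrow> block_sizes b n ns \<longrightarrow> GC1 c d ms ns \<longrightarrow>
           top_singular_vectors r (blown_up P ms ns + W m n \<omega>) Y X \<longrightarrow>
             k_variance a Y \<le> C * ((real m + real n) / (real m * real n)) \<and>
             k_variance b X \<le> C * ((real m + real n) / (real m * real n))"
proof -
  have P: "P \<in> carrier_mat a b" using assms(2) by (simp add: pattern_matrix_def)
  obtain js where inj: "inj_on js {..<r}" and js: "\<And>l. l < r \<Longrightarrow> js l < b"
    and ker: "\<And>v. v \<in> carrier_vec r \<Longrightarrow>
      Matrix.mat a r (\<lambda>(i, l). P $$ (i, js l)) *\<^sub>v v = 0\<^sub>v a \<Longrightarrow> v = 0\<^sub>v r"
    using vec_space.rank_independent_columns[OF P assms(3)] by metis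
  obtain \<sigma> where \<sigma>: "\<sigma> > 0" "\<And>v. v \<in> carrier_vec r \<Longrightarrow> \<sigma> * (v \<bullet> v) \<le>
      (Matrix.mat a r (\<lambda>(i, l). P $$ (i, js l)) *\<^sub>v v) \<bullet> (Matrix.mat a r (\<lambda>(i, l). P $$ (i, js l)) *\<^sub>v v)"
    using full_column_rank_bound[of "Matrix.mat a r (\<lambda>(i, l). P $$ (i, js l))" a r] ker by auto
  define \<eta> where "\<eta> = c * d * \<sigma> / 4"
  have \<eta>: "\<eta> > 0" using assms \<sigma> by (simp add: \<eta>_def)
  define L where "L = (14 * K)\<^sup>2"
  have L: "L > 0" using assms by (simp add: L_def)
  \<comment> \<open>For m, n \<ge> N both 2 L \<le> \<eta> m and 2 L \<le> \<eta> n. Multiplying by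
    n and m and adding gives L (m + n) \<le> \<eta> m n, the smallness required of the noise.
    \<open>Suc\<close> makes m and n positive.\<close>
  define N where "N = Suc (nat \<lceil>2 * L / \<eta>\<rceil>)"
  have "AE \<omega> in M. \<exists>k. \<forall>m n. 0 < m \<longrightarrow> 0 < n \<longrightarrow> k \<le> m + n \<longrightarrow>
           opnorm_le m n (\<lambda>i j. W m n \<omega> $$ (i, j)) (14 * K * sqrt (real (m + n)))"
    using prob_space.wigner_opnorm_eventually[OF assms(1) assms(5,4)] .
  then have "AE \<omega> in M. \<exists>m0 n0. \<forall>m\<ge>m0. \<forall>n\<ge>n0. \<forall>ms ns Y X.
           block_sizes a m ms \<longrightarrow> block_sizes b n ns \<longrightarrow> GC1 c d ms ns \<longrightarrow>
           top_singular_vectors r (blown_up P ms ns + W m n \<omega>) Y X \<longrightarrow>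
             k_variance a Y \<le> real r * L / \<eta> * ((real m + real n) / (real m * real n)) \<and>
             k_variance b X \<le> real r * L / \<eta> * ((real m + real n) / (real m * real n))"
    using AE_space
  proof eventually_elim
    case (elim \<omega>)
    then obtain k where k: "\<And>m n. 0 < m \<Longrightarrow> 0 < n \<Longrightarrow> k \<le> m + n \<Longrightarrow>
           opnorm_le m n (\<lambda>i j. W m n \<omega> $$ (i, j)) (14 * K * sqrt (real (m + n)))" by blast
    \<comment> \<open>The thresholds are \<open>N + k\<close> for m and \<open>N\<close> for n:
      enlarging one of them by \<open>k\<close> already forces k \<le> m + n.\<close>
    have bound: "k_variance a Y \<le> real r * L / \<eta> * ((real m + real n) / (real m * real n)) \<and>
        k_variance b X \<le> real r * L / \<eta> * ((real m + real n) / (real m * real n))"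
      if mn: "m \<ge> N + k" "n \<ge> N" and ms: "block_sizes a m ms" and ns: "block_sizes b n ns"
        and gc: "GC1 c d ms ns" and top: "top_singular_vectors r (blown_up P ms ns + W m n \<omega>) Y X"
      for m n ms ns Y X
    proof -
      let ?s = "14 * K * sqrt (real (m + n))"
      have pos: "0 < m" "0 < n" using mn by (auto simp: N_def)
      have Wc: "W m n \<omega> \<in> carrier_mat m n"
        using assms(5)[of m n] elim by (simp add: wigner_noise_def)
      have s: "opnorm_le m n (\<lambda>i j. W m n \<omega> $$ (i, j)) ?s" using k[OF pos] mn by simp
      have s2: "?s\<^sup>2 = L * (real m + real n)" by (simp add: L_def power_mult_distrib)
      have \<eta>4: "c * d * \<sigma> * (real m * real n) / 4 = \<eta> * (real m * real n)" by (simp add: \<eta>_def)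
      have "2 * L / \<eta> \<le> real m" "2 * L / \<eta> \<le> real n" using mn unfolding N_def by linarith+
      then have "2 * L \<le> \<eta> * real m" "2 * L \<le> \<eta> * real n" using \<eta> by (simp_all add: field_simps)
      then have "2 * L * real n \<le> \<eta> * real m * real n" "2 * L * real m \<le> \<eta> * real n * real m"
        by (auto intro: mult_right_mono)
      then have "?s\<^sup>2 \<le> c * d * \<sigma> * (real m * real n) / 4"
        unfolding s2 \<eta>4 by (simp add: algebra_simps)
      note kv = k_variance_top_singular_vectors_le
        [OF assms(2) inj js \<sigma> ms ns gc \<open>0 < c\<close> \<open>0 < d\<close> pos Wc s this top]
      have "real r * (?s\<^sup>2 / (c * d * \<sigma> * (real m * real n) / 4)) =
          real r * L / \<eta> * ((real m + real n) / (real m * real n))"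
        unfolding s2 \<eta>4 by simp
      then show ?thesis using kv by simp
    qed
    then show ?case by blast
  qed
  then show ?thesis by blast
qed

end
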